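(* Let $n\geqslant 3$ be odd and let $\mathbf K=\mathbf S_n$ be the $n$-element Sugihara chain, viewed as a distributive quasi relation algebra. If $\mathbf L$ is a representable distributive quasi relation algebra, then the nested sum $\mathbf S_n[\mathbf L]$ is representable. Moreover, if $\mathbf L$ is finitely representable, then $\mathbf S_n[\mathbf L]$ is finitely representable.
   Context: A residuated lattice is an algebra $\langle A,\wedge,\vee,\cdot,\backslash,/,1\rangle$ such that $\langle A,\wedge,\vee\rangle$ is a lattice, $\langle A,\cdot,1\rangle$ is a monoid, and for all $a,b,c\in A$: $a\cdot b\leqslant c \iff a\leqslant c/b\iff b\leqslant a\backslash c$. An InFL-algebra is an algebra $\langle A,\wedge,\vee,\cdot,{\sim},-,1,0\rangle$ with $0=-1={\sim}1$, where $\langle A,\wedge,\vee\rangle$ is a lattice, $\langle A,\cdot,1\rangle$ is a monoid and $a\cdot b\leqslant c\iff a\leqslant -(b\cdot{\sim}c)\iff b\leqslant {\sim}(-c\cdot a)$; it is a residuated lattice with $c/b=-(b\cdot{\sim}c)$, $a\backslash c={\sim}(-c\cdot a)$, and ${\sim}a=a\backslash 0$, $-a=0/a$, ${\sim}{-}a=a={-}{\sim}a$. Put $a+b={\sim}(-a\cdot -b)$. A quasi relation algebra (qRA) is an algebra $\langle A,\wedge,\vee,\cdot,{\sim},-,\neg,1,0\rangle$ whose $\neg$-free reduct is an InFL-algebra and which satisfies $\neg\neg a=a$, $\neg(a\vee b)=\neg a\wedge\neg b$, $\neg({\sim}a)=-(\neg a)$ and $\neg(a\cdot b)=\neg a+\neg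 b$. A distributive quasi relation algebra (DqRA) is a qRA whose lattice reduct is distributive. For odd $n=2k+1$ ($k\geqslant1$), $\mathbf S_n$ has universe $\{a_{-k},\dots,a_{-1},a_0,a_1,\dots,a_k\}$, ordered as a chain by index, with ${\sim}a_j=-a_j=\neg a_j=a_{-j}$, $1=0=a_0$, and $a_i\cdot a_j=a_i$ if $|j|<|i|$, $a_j$ if $|i|<|j|$, $a_{\min\{i,j\}}$ if $|i|=|j|$. Nested sum: let $\mathbf K,\mathbf L$ be qRAs with $K\cap L=\varnothing$ and $1_{\mathbf K}$ totally irreducible (i.e. for every non-nullary operation $f$ of $\mathbf K$, $f(b_1,\dots,b_n)=1_{\mathbf K}$ implies $b_i=1_{\mathbf K}$ for some $i$; this holds for $\mathbf K=\mathbf S_n$, $n$ odd). The universe of $\mathbf K[\mathbf L]$ is $K[L]=(K\setminus\{1_{\mathbf K}\})\cup L$, with $1_{\mathbf K[\mathbf L]}=1_{\mathbf L}$, $0_{\mathbf K[\mathbf L]}=0_{\mathbf L}$. For $\star\in\{\cdot,\backslash,/\}$, $m_0\star_{\mathbf K[\mathbf L]}m_1$ equals: $m_0\star_{\mathbf K}m_1$ if $m_0,m_1\in K\setminus\{1_{\mathbf K}\}$; $m_0\star_{\mathbf L}m_1$ if $m_0,m_1\in L$; $m_0\star_{\mathbf K}1_{\mathbf K}$ if $m_0\in K\setminus\{1_{\mathbf K}\}$, $m_1\in L$; $1_{\mathbf K}\star_{\mathbf K}m_1$ if $m_0\in L$, $m_1\in K\setminus\{1_{\mathbf K}\}$. The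 operations $\wedge_{\mathbf K[\mathbf L]}$, $\vee_{\mathbf K[\mathbf L]}$ are commutative, agree with those of $\mathbf K$ on $K\setminus\{1_{\mathbf K}\}$ and with those of $\mathbf L$ on $L$, and for $k\in K\setminus\{1_{\mathbf K}\}$, $\ell\in L$: $k\wedge\ell=\ell$ if $k\geqslant_{\mathbf K}1_{\mathbf K}$ and $k\wedge\ell=k\wedge_{\mathbf K}1_{\mathbf K}$ otherwise; $k\vee\ell=\ell$ if $k\leqslant_{\mathbf K}1_{\mathbf K}$ and $k\vee\ell=k\vee_{\mathbf K}1_{\mathbf K}$ otherwise. The linear negations are ${\sim}_{\mathbf K[\mathbf L]}m=m\backslash_{\mathbf K[\mathbf L]}0_{\mathbf K[\mathbf L]}$ and $-_{\mathbf K[\mathbf L]}m=0_{\mathbf K[\mathbf L]}/_{\mathbf K[\mathbf L]}m$, and $\neg_{\mathbf K[\mathbf L]}m$ is $\neg_{\mathbf L}m$ for $m\in L$ and $\neg_{\mathbf K}m$ for $m\in K\setminus\{1_{\mathbf K}\}$. Representability: for binary relations, $R^\smile=\{(x,y)\mid (y,x)\in R\}$ and $R\mathbin{;}S=\{(x,y)\mid \exists z\,((x,z)\in R,\ (z,y)\in S)\}$; functions are identified with their graphs. Let $(X,\leqslant)$ be a poset, $E$ an equivalence relation on $X$ with ${\leqslant}\subseteq E$, and write $R^c=E\setminus R$ for $R\subseteq E$. Order $E$ by $(u,v)\preccurlyeq(x,y)$ iff $x\leqslant u$ and $v\leqslant y$; let $\mathbf E=(E,\preccurlyeq)$ and let $\mathsf{Up}(\mathbf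 E)$ be the set of its up-sets. Let $\alpha:X\to X$ be an order automorphism and $\beta:X\to X$ a self-inverse dual order automorphism with $\alpha,\beta\subseteq E$ and $\beta=\alpha\mathbin{;}\beta\mathbin{;}\alpha$. Then $\mathbf{Dq}(\mathbf E)=\langle\mathsf{Up}(\mathbf E),\cap,\cup,\mathbin{;},{\sim},-,\neg,1,0\rangle$ with $1={\leqslant}$, $0=\alpha\mathbin{;}({\leqslant}^c)^{\smile}$, ${\sim}R=(R^{c})^{\smile}\mathbin{;}\alpha$, $-R=\alpha\mathbin{;}(R^{c})^{\smile}$, $\neg R=\alpha\mathbin{;}\beta\mathbin{;}R^c\mathbin{;}\beta$ is a DqRA. A DqRA is representable if it is isomorphic to a subalgebra of some $\mathbf{Dq}(\mathbf E)$ (equivalently, to a subalgebra of a product of algebras $\mathbf{Dq}(\mathbf E)$ with $E=X^2$). It is finitely representable if the poset $(X,\leqslant)$ used in the representation can be taken finite. *)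

theory Defs
  imports "HOL-Algebra.Group" "HOL-Library.Infinite_Typeclass"
begin

section \<open>Distributive quasi relation algebras\<close>

record 'a qra = "'a monoid" +
  wedge :: "'a \<Rightarrow> 'a \<Rightarrow> 'a" (infixl \<open>\<curlywedge>\<index>\<close> 70)
  vee   :: "'a \<Rightarrow> 'a \<Rightarrow> 'a" (infixl \<open>\<curlyvee>\<index>\<close> 65)
  lneg  :: "'a \<Rightarrow> 'a" (\<open>\<sim>\<index> _\<close> [81] 80)  \<comment> \<open>the linear negation \<open>\<sim>\<close>\<close>
  rneg  :: "'a \<Rightarrow> 'a" (\<open>\<ominus>\<index> _\<close> [81] 80)  \<comment> \<open>the linear negation \<open>-\<close>\<close>
  qneg  :: "'a \<Rightarrow> 'a" (\<open>\<rightharpoondown>\<index> _\<close> [81] 80)  \<comment> \<open>the involution \<open>\<not>\<close>\<close>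
  zero  :: 'a (\<open>\<zero>\<index>\<close>)

definition qle :: "('a, 'm) qra_scheme \<Rightarrow> 'a \<Rightarrow> 'a \<Rightarrow> bool" (infix \<open>\<preceq>\<index>\<close> 50)
  where "a \<preceq>\<^bsub>A\<^esub> b \<longleftrightarrow> a \<curlywedge>\<^bsub>A\<^esub> b = a"

text \<open>\<open>lres A a c\<close> is \<open>a \ c\<close>, \<open>rres A c b\<close> is \<open>c / b\<close>, and \<open>qplus A a b\<close> is \<open>a + b\<close>.
  The reversed factors in \<open>a + b = \<sim>(-b \<cdot> -a)\<close> matter: without the reversal
  \<open>\<not>(a \<cdot> b) = \<not>a + \<not>b\<close> fails in \<open>Dq(E)\<close> already for relations on a two-element chain.\<close>

definition lres :: "('a, 'm) qra_scheme \<Rightarrow> 'a \<Rightarrow> 'a \<Rightarrow> 'a"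
  where "lres A a c = \<sim>\<^bsub>A\<^esub> ((\<ominus>\<^bsub>A\<^esub> c) \<otimes>\<^bsub>A\<^esub> a)"

definition rres :: "('a, 'm) qra_scheme \<Rightarrow> 'a \<Rightarrow> 'a \<Rightarrow> 'a"
  where "rres A c b = \<ominus>\<^bsub>A\<^esub> (b \<otimes>\<^bsub>A\<^esub> (\<sim>\<^bsub>A\<^esub> c))"

definition qplus :: "('a, 'm) qra_scheme \<Rightarrow> 'a \<Rightarrow> 'a \<Rightarrow> 'a"
  where "qplus A a b = \<sim>\<^bsub>A\<^esub> ((\<ominus>\<^bsub>A\<^esub> b) \<otimes>\<^bsub>A\<^esub> (\<ominus>\<^bsub>A\<^esub> a))"

locale InFL_algebra = monoid A for A :: "('a, 'm) qra_scheme" (structure) +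
  assumes wedge_closed: "\<lbrakk>a \<in> carrier A; b \<in> carrier A\<rbrakk> \<Longrightarrow> a \<curlywedge> b \<in> carrier A"
    and vee_closed: "\<lbrakk>a \<in> carrier A; b \<in> carrier A\<rbrakk> \<Longrightarrow> a \<curlyvee> b \<in> carrier A"
    and lneg_closed: "a \<in> carrier A \<Longrightarrow> \<sim> a \<in> carrier A"
    and rneg_closed: "a \<in> carrier A \<Longrightarrow> \<ominus> a \<in> carrier A"
    and zero_closed: "\<zero> \<in> carrier A"
    and wedge_commute: "\<lbrakk>a \<in> carrier A; b \<in> carrier A\<rbrakk> \<Longrightarrow> a \<curlywedge> b = b \<curlywedge> a"
    and vee_commute: "\<lbrakk>a \<in> carrier A; b \<in> carrier A\<rbrakk> \<Longrightarrow> a \<curlyvee> b = b \<curlyvee> a"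
    and wedge_assoc: "\<lbrakk>a \<in> carrier A; b \<in> carrier A; c \<in> carrier A\<rbrakk>
          \<Longrightarrow> (a \<curlywedge> b) \<curlywedge> c = a \<curlywedge> (b \<curlywedge> c)"
    and vee_assoc: "\<lbrakk>a \<in> carrier A; b \<in> carrier A; c \<in> carrier A\<rbrakk>
          \<Longrightarrow> (a \<curlyvee> b) \<curlyvee> c = a \<curlyvee> (b \<curlyvee> c)"
    and wedge_absorb: "\<lbrakk>a \<in> carrier A; b \<in> carrier A\<rbrakk> \<Longrightarrow> a \<curlywedge> (a \<curlyvee> b) = a"
    and vee_absorb: "\<lbrakk>a \<in> carrier A; b \<in> carrier A\<rbrakk> \<Longrightarrow> a \<curlyvee> (a \<curlywedge> b) = a"
    and zero_rneg: "\<zero> = \<ominus> \<one>"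
    and zero_lneg: "\<zero> = \<sim> \<one>"
    and residual_right: "\<lbrakk>a \<in> carrier A; b \<in> carrier A; c \<in> carrier A\<rbrakk>
          \<Longrightarrow> a \<otimes> b \<preceq> c \<longleftrightarrow> a \<preceq> \<ominus> (b \<otimes> (\<sim> c))"
    and residual_left: "\<lbrakk>a \<in> carrier A; b \<in> carrier A; c \<in> carrier A\<rbrakk>
          \<Longrightarrow> a \<otimes> b \<preceq> c \<longleftrightarrow> b \<preceq> \<sim> ((\<ominus> c) \<otimes> a)"

locale qRA = InFL_algebra A for A :: "('a, 'm) qra_scheme" (structure) +
  assumes qneg_closed: "a \<in> carrier A \<Longrightarrow> \<rightharpoondown> a \<in> carrier A"
    and qneg_qneg: "a \<in> carrier A \<Longrightarrow> \<rightharpoondown> (\<rightharpoondown> a) = a"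
    and qneg_vee: "\<lbrakk>a \<in> carrier A; b \<in> carrier A\<rbrakk> \<Longrightarrow> \<rightharpoondown> (a \<curlyvee> b) = (\<rightharpoondown> a) \<curlywedge> (\<rightharpoondown> b)"
    and qneg_lneg: "a \<in> carrier A \<Longrightarrow> \<rightharpoondown> (\<sim> a) = \<ominus> (\<rightharpoondown> a)"
    and qneg_mult: "\<lbrakk>a \<in> carrier A; b \<in> carrier A\<rbrakk>
          \<Longrightarrow> \<rightharpoondown> (a \<otimes> b) = qplus A (\<rightharpoondown> a) (\<rightharpoondown> b)"

locale DqRA = qRA A for A :: "('a, 'm) qra_scheme" (structure) +
  assumes wedge_vee_distrib: "\<lbrakk>a \<in> carrier A; b \<in> carrier A; c \<in> carrier A\<rbrakk>
          \<Longrightarrow> a \<curlywedge> (b \<curlyvee> c) = (a \<curlywedge> b) \<curlyvee> (a \<curlywedge> c)"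


section \<open>Finite Sugihara chains of odd size\<close>

text \<open>The element \<open>a\<^sub>j\<close> is encoded as the integer \<open>j\<close>; for \<open>n = 2k + 1\<close> we have \<open>k = n div 2\<close>.
  Only odd \<open>n\<close> are meaningful here.\<close>

definition sugihara :: "nat \<Rightarrow> int qra"
  where "sugihara n =
    \<lparr> carrier = {- int (n div 2) .. int (n div 2)},
      mult = (\<lambda>i j. if \<bar>j\<bar> < \<bar>i\<bar> then i else if \<bar>i\<bar> < \<bar>j\<bar> then j else min i j),
      one = 0,
      wedge = min,
      vee = max,
      lneg = uminus,
      rneg = uminus,
      qneg = uminus,
      zero = 0 \<rparr>"


section \<open>Nested sums\<close>

text \<open>Disjointness of \<open>K\<close> and \<open>L\<close> is realised by the sum type: \<open>Inl\<close> marks the elements of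
  \<open>K\<close> other than the unit of \<open>K\<close>, and \<open>Inr\<close> those of \<open>L\<close>. The construction is intended for
  \<open>K\<close> whose unit is totally irreducible, so that the operations stay inside the carrier.\<close>

fun nested_op :: "'a \<Rightarrow> ('a \<Rightarrow> 'a \<Rightarrow> 'a) \<Rightarrow> ('b \<Rightarrow> 'b \<Rightarrow> 'b) \<Rightarrow> 'a + 'b \<Rightarrow> 'a + 'b \<Rightarrow> 'a + 'b"
  where
    "nested_op e f g (Inl x) (Inl y) = Inl (f x y)"
  | "nested_op e f g (Inr x) (Inr y) = Inr (g x y)"
  | "nested_op e f g (Inl x) (Inr y) = Inl (f x e)"
  | "nested_op e f g (Inr x) (Inl y) = Inl (f e y)"

definition nested_mult :: "'a qra \<Rightarrow> 'b qra \<Rightarrow> 'a + 'b \<Rightarrow> 'a + 'b \<Rightarrow> 'a + 'b"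
  where "nested_mult K L = nested_op \<one>\<^bsub>K\<^esub> (mult K) (mult L)"

definition nested_lres :: "'a qra \<Rightarrow> 'b qra \<Rightarrow> 'a + 'b \<Rightarrow> 'a + 'b \<Rightarrow> 'a + 'b"
  where "nested_lres K L = nested_op \<one>\<^bsub>K\<^esub> (lres K) (lres L)"

definition nested_rres :: "'a qra \<Rightarrow> 'b qra \<Rightarrow> 'a + 'b \<Rightarrow> 'a + 'b \<Rightarrow> 'a + 'b"
  where "nested_rres K L = nested_op \<one>\<^bsub>K\<^esub> (rres K) (rres L)"

fun nested_wedge :: "'a qra \<Rightarrow> 'b qra \<Rightarrow> 'a + 'b \<Rightarrow> 'a + 'b \<Rightarrow> 'a + 'b"
  where
    "nested_wedge K L (Inl x) (Inl y) = Inl (x \<curlywedge>\<^bsub>K\<^esub> y)"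
  | "nested_wedge K L (Inr x) (Inr y) = Inr (x \<curlywedge>\<^bsub>L\<^esub> y)"
  | "nested_wedge K L (Inl x) (Inr y) = (if \<one>\<^bsub>K\<^esub> \<preceq>\<^bsub>K\<^esub> x then Inr y else Inl (x \<curlywedge>\<^bsub>K\<^esub> \<one>\<^bsub>K\<^esub>))"
  | "nested_wedge K L (Inr y) (Inl x) = (if \<one>\<^bsub>K\<^esub> \<preceq>\<^bsub>K\<^esub> x then Inr y else Inl (x \<curlywedge>\<^bsub>K\<^esub> \<one>\<^bsub>K\<^esub>))"

fun nested_vee :: "'a qra \<Rightarrow> 'b qra \<Rightarrow> 'a + 'b \<Rightarrow> 'a + 'b \<Rightarrow> 'a + 'b"
  where
    "nested_vee K L (Inl x) (Inl y) = Inl (x \<curlyvee>\<^bsub>K\<^esub> y)"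
  | "nested_vee K L (Inr x) (Inr y) = Inr (x \<curlyvee>\<^bsub>L\<^esub> y)"
  | "nested_vee K L (Inl x) (Inr y) = (if x \<preceq>\<^bsub>K\<^esub> \<one>\<^bsub>K\<^esub> then Inr y else Inl (x \<curlyvee>\<^bsub>K\<^esub> \<one>\<^bsub>K\<^esub>))"
  | "nested_vee K L (Inr y) (Inl x) = (if x \<preceq>\<^bsub>K\<^esub> \<one>\<^bsub>K\<^esub> then Inr y else Inl (x \<curlyvee>\<^bsub>K\<^esub> \<one>\<^bsub>K\<^esub>))"

definition nested_sum :: "'a qra \<Rightarrow> 'b qra \<Rightarrow> ('a + 'b) qra"
  where "nested_sum K L =
    \<lparr> carrier = Inl ` (carrier K - {\<one>\<^bsub>K\<^esub>}) \<union> Inr ` carrier L,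
      mult = nested_mult K L,
      one = Inr \<one>\<^bsub>L\<^esub>,
      wedge = nested_wedge K L,
      vee = nested_vee K L,
      lneg = (\<lambda>m. nested_lres K L m (Inr \<zero>\<^bsub>L\<^esub>)),
      rneg = (\<lambda>m. nested_rres K L (Inr \<zero>\<^bsub>L\<^esub>) m),
      qneg = map_sum (qneg K) (qneg L),
      zero = Inr \<zero>\<^bsub>L\<^esub> \<rparr>"


section \<open>Algebras of binary relations\<close>

definition graph_on :: "'x set \<Rightarrow> ('x \<Rightarrow> 'x) \<Rightarrow> 'x rel"
  where "graph_on X f = {(x, f x) |x. x \<in> X}"

definition order_automorphism :: "'x set \<Rightarrow> 'x rel \<Rightarrow> ('x \<Rightarrow> 'x) \<Rightarrow> bool"
  where "order_automorphism X leX f \<longleftrightarrow>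
    bij_betw f X X \<and> (\<forall>x\<in>X. \<forall>y\<in>X. (x, y) \<in> leX \<longleftrightarrow> (f x, f y) \<in> leX)"

definition dual_order_automorphism :: "'x set \<Rightarrow> 'x rel \<Rightarrow> ('x \<Rightarrow> 'x) \<Rightarrow> bool"
  where "dual_order_automorphism X leX f \<longleftrightarrow>
    bij_betw f X X \<and> (\<forall>x\<in>X. \<forall>y\<in>X. (x, y) \<in> leX \<longleftrightarrow> (f y, f x) \<in> leX)"

text \<open>The data \<open>(X, \<leX>, E, \<alpha>, \<beta>)\<close> from which \<open>Dq(E)\<close> is built. Relational composition is
  \<open>relcomp\<close>, in the same (diagrammatic) order as \<open>;\<close>.\<close>

definition dq_frame :: "'x set \<Rightarrow> 'x rel \<Rightarrow> 'x rel \<Rightarrow> ('x \<Rightarrow> 'x) \<Rightarrow> ('x \<Rightarrow> 'x) \<Rightarrow> bool"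
  where "dq_frame X leX E \<alpha> \<beta> \<longleftrightarrow>
    partial_order_on X leX \<and> equiv X E \<and> leX \<subseteq> E \<and>
    order_automorphism X leX \<alpha> \<and> dual_order_automorphism X leX \<beta> \<and> (\<forall>x\<in>X. \<beta> (\<beta> x) = x) \<and>
    graph_on X \<alpha> \<subseteq> E \<and> graph_on X \<beta> \<subseteq> E \<and>
    graph_on X \<beta> = graph_on X \<alpha> O graph_on X \<beta> O graph_on X \<alpha>"

definition pair_le :: "'x rel \<Rightarrow> 'x \<times> 'x \<Rightarrow> 'x \<times> 'x \<Rightarrow> bool"
  where "pair_le leX p q \<longleftrightarrow> (fst q, fst p) \<in> leX \<and> (snd p, snd q) \<in> leX"

definition up_sets :: "'x rel \<Rightarrow> 'x rel \<Rightarrow> 'x rel set"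
  where "up_sets leX E = {R. R \<subseteq> E \<and> (\<forall>p\<in>R. \<forall>q\<in>E. pair_le leX p q \<longrightarrow> q \<in> R)}"

definition Dq :: "'x set \<Rightarrow> 'x rel \<Rightarrow> 'x rel \<Rightarrow> ('x \<Rightarrow> 'x) \<Rightarrow> ('x \<Rightarrow> 'x) \<Rightarrow> 'x rel qra"
  where "Dq X leX E \<alpha> \<beta> =
    \<lparr> carrier = up_sets leX E,
      mult = (O),
      one = leX,
      wedge = (\<inter>),
      vee = (\<union>),
      lneg = (\<lambda>R. (E - R)\<inverse> O graph_on X \<alpha>),
      rneg = (\<lambda>R. graph_on X \<alpha> O (E - R)\<inverse>),
      qneg = (\<lambda>R. graph_on X \<alpha> O graph_on X \<beta> O (E - R) O graph_on X \<beta>),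
      zero = graph_on X \<alpha> O (E - leX)\<inverse> \<rparr>"


section \<open>Representability\<close>

definition qra_hom :: "'a qra \<Rightarrow> 'b qra \<Rightarrow> ('a \<Rightarrow> 'b) set"
  where "qra_hom A B = {h. h \<in> carrier A \<rightarrow> carrier B \<and>
    (\<forall>a\<in>carrier A. \<forall>b\<in>carrier A.
        h (a \<otimes>\<^bsub>A\<^esub> b) = h a \<otimes>\<^bsub>B\<^esub> h b \<and>
        h (a \<curlywedge>\<^bsub>A\<^esub> b) = h a \<curlywedge>\<^bsub>B\<^esub> h b \<and>
        h (a \<curlyvee>\<^bsub>A\<^esub> b) = h a \<curlyvee>\<^bsub>B\<^esub> h b) \<and>
    (\<forall>a\<in>carrier A.
        h (\<sim>\<^bsub>A\<^esub> a) = \<sim>\<^bsub>B\<^esub> (h a) \<and> h (\<ominus>\<^bsub>A\<^esub> a) = \<ominus>\<^bsub>B\<^esub> (h a) \<and> h (\<rightharpoondown>\<^bsub>A\<^esub> a) = \<rightharpoondown>\<^bsub>B\<^esub> (h a)) \<and>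
    h \<one>\<^bsub>A\<^esub> = \<one>\<^bsub>B\<^esub> \<and> h \<zero>\<^bsub>A\<^esub> = \<zero>\<^bsub>B\<^esub>}"

definition qra_iso :: "'a qra \<Rightarrow> 'b qra \<Rightarrow> ('a \<Rightarrow> 'b) set"
  where "qra_iso A B = {h \<in> qra_hom A B. bij_betw h (carrier A) (carrier B)}"

definition subuniverse :: "'a set \<Rightarrow> 'a qra \<Rightarrow> bool"
  where "subuniverse S A \<longleftrightarrow> S \<subseteq> carrier A \<and> \<one>\<^bsub>A\<^esub> \<in> S \<and> \<zero>\<^bsub>A\<^esub> \<in> S \<and>
    (\<forall>a\<in>S. \<forall>b\<in>S. a \<otimes>\<^bsub>A\<^esub> b \<in> S \<and> a \<curlywedge>\<^bsub>A\<^esub> b \<in> S \<and> a \<curlyvee>\<^bsub>A\<^esub> b \<in> S) \<and>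
    (\<forall>a\<in>S. \<sim>\<^bsub>A\<^esub> a \<in> S \<and> \<ominus>\<^bsub>A\<^esub> a \<in> S \<and> \<rightharpoondown>\<^bsub>A\<^esub> a \<in> S)"

definition iso_to_subalgebra :: "'a qra \<Rightarrow> 'b qra \<Rightarrow> bool"
  where "iso_to_subalgebra A B \<longleftrightarrow> (\<exists>S h. subuniverse S B \<and> h \<in> qra_iso A (B\<lparr>carrier := S\<rparr>))"

text \<open>HOL cannot quantify over the type of points of the representing poset, so that type is a
  parameter \<open>'x\<close>; the poset itself is carried by an arbitrary subset of it. Enlarging \<open>'x\<close> only
  adds representations, see \<open>representable_mono\<close> below, so a representation over any type is
  also one over an infinite type such as \<open>'x \<times> nat\<close>.\<close>

definition representable :: "'x itself \<Rightarrow> 'a qra \<Rightarrow> bool"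
  where "representable (_ :: 'x itself) A \<longleftrightarrow> DqRA A \<and>
    (\<exists>(X :: 'x set) leX E \<alpha> \<beta>. dq_frame X leX E \<alpha> \<beta> \<and> iso_to_subalgebra A (Dq X leX E \<alpha> \<beta>))"

definition finitely_representable :: "'x itself \<Rightarrow> 'a qra \<Rightarrow> bool"
  where "finitely_representable (_ :: 'x itself) A \<longleftrightarrow> DqRA A \<and>
    (\<exists>(X :: 'x set) leX E \<alpha> \<beta>. finite X \<and> dq_frame X leX E \<alpha> \<beta> \<and>
        iso_to_subalgebra A (Dq X leX E \<alpha> \<beta>))"

context
  fixes f :: "'x \<Rightarrow> 'y"
  assumes inj_f: "inj f"
begin

private definition F :: "'x rel \<Rightarrow> 'y rel" where "F R = map_prod f f ` R"
private definition tr :: "('x \<Rightarrow> 'x) \<Rightarrow> 'y \<Rightarrow> 'y" where "tr g = f \<circ> g \<circ> inv_into UNIV f"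

private lemma f_eq [simp]: "f x = f y \<longleftrightarrow> x = y"
  using inj_f by (rule inj_eq)

private lemma tr_f [simp]: "tr g (f x) = f (g x)"
  using inj_f by (simp add: tr_def)

private lemma inj_F: "inj F"
proof -
  have "inj (map_prod f f)"
    using inj_f inj_f by (rule prod.inj_map)
  from inj_on_image_Pow[OF this] show ?thesis
    by (simp add: F_def[abs_def])
qed

private lemma F_mem [simp]: "(f x, f y) \<in> F R \<longleftrightarrow> (x, y) \<in> R"
  by (auto simp: F_def)

private lemma F_memE: "p \<in> F R \<Longrightarrow> (\<And>x y. p = (f x, f y) \<Longrightarrow> (x, y) \<in> R \<Longrightarrow> P) \<Longrightarrow> P"
  by (auto simp: F_def)

private lemma F_comp: "F (R O S) = F R O F S"
  by (auto elim!: F_memE intro: relcompI[of _ "f _"])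

private lemma F_conv: "F (R\<inverse>) = (F R)\<inverse>"
  by (auto elim!: F_memE)

private lemma F_diff: "F (R - S) = F R - F S"
  by (auto elim!: F_memE)

private lemma F_int: "F (R \<inter> S) = F R \<inter> F S"
  by (auto elim!: F_memE)

private lemma F_un: "F (R \<union> S) = F R \<union> F S"
  by (auto elim!: F_memE)

private lemma F_subset: "F R \<subseteq> F S \<longleftrightarrow> R \<subseteq> S"
  by (auto elim!: F_memE dest: subsetD[of "F R" "F S" "(f _, f _)"])

private lemma F_graph: "F (graph_on X g) = graph_on (f ` X) (tr g)"
  by (auto simp: graph_on_def F_def image_iff)

private lemma bij_tr: "bij_betw g X X \<Longrightarrow> bij_betw (tr g) (f ` X) (f ` X)"
proof -
  assume g: "bij_betw g X X"
  have "tr g ` (f ` X) = f ` (g ` X)"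
    by (simp add: image_image)
  with g show ?thesis
    by (auto simp: bij_betw_def inj_on_def)
qed

private lemma dq_frame_F:
  assumes "dq_frame X R E \<alpha> \<beta>"
  shows "dq_frame (f ` X) (F R) (F E) (tr \<alpha>) (tr \<beta>)"
proof -
  note A = assms[unfolded dq_frame_def order_automorphism_def dual_order_automorphism_def]
  have tr: "trans (F S)" if "trans S" for S
    using that by (auto simp: trans_def elim!: F_memE)
  have po: "partial_order_on (f ` X) (F R)"
  proof -
    have "R \<subseteq> X \<times> X" "refl_on X R" "trans R" "antisym R"
      using A by (auto simp: order_on_defs)
    then show ?thesis
      by (auto simp: order_on_defs tr refl_on_def antisym_def elim!: F_memE)
  qed
  have eq: "equiv (f ` X) (F E)"
  proof -
    have "E \<subseteq> X \<times> X" "refl_on X E" "trans E" "sym E"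
      using A by (auto simp: equiv_def)
    then show ?thesis
      by (auto simp: equiv_def tr refl_on_def sym_def elim!: F_memE)
  qed
  show ?thesis
    unfolding dq_frame_def order_automorphism_def dual_order_automorphism_def
      F_graph[symmetric] F_comp[symmetric] F_subset
    using A po eq by (auto simp: bij_tr)
qed

private lemma up_sets_F: "S \<in> up_sets R E \<Longrightarrow> F S \<in> up_sets (F R) (F E)"
  by (fastforce simp: up_sets_def pair_le_def F_subset elim!: F_memE)

private lemma iso_to_subalgebra_F:
  assumes "iso_to_subalgebra A (Dq X R E \<alpha> \<beta>)"
  shows "iso_to_subalgebra A (Dq (f ` X) (F R) (F E) (tr \<alpha>) (tr \<beta>))"
proof -
  obtain S h where S: "subuniverse S (Dq X R E \<alpha> \<beta>)"
    and h: "h \<in> qra_iso A (Dq X R E \<alpha> \<beta>\<lparr>carrier := S\<rparr>)"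
    using assms by (auto simp: iso_to_subalgebra_def)
  note ops = F_graph[symmetric] F_comp[symmetric] F_diff[symmetric] F_conv[symmetric]
    F_int[symmetric] F_un[symmetric]
  have "subuniverse (F ` S) (Dq (f ` X) (F R) (F E) (tr \<alpha>) (tr \<beta>))"
    using S by (auto simp: subuniverse_def Dq_def ops up_sets_F)
  moreover have "F \<circ> h \<in> qra_iso A (Dq (f ` X) (F R) (F E) (tr \<alpha>) (tr \<beta>)\<lparr>carrier := F ` S\<rparr>)"
  proof -
    have "bij_betw F S (F ` S)"
      using inj_F by (auto simp: bij_betw_def intro: inj_on_subset)
    with h show ?thesis
      by (auto simp: qra_iso_def qra_hom_def Dq_def ops intro: bij_betw_trans)
  qed
  ultimately show ?thesis
    unfolding iso_to_subalgebra_def by blast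
qed

lemma representable_mono: "representable TYPE('x) A \<Longrightarrow> representable TYPE('y) A"
  unfolding representable_def using dq_frame_F iso_to_subalgebra_F by blast

lemma finitely_representable_mono:
  "finitely_representable TYPE('x) A \<Longrightarrow> finitely_representable TYPE('y) A"
  unfolding finitely_representable_def using dq_frame_F iso_to_subalgebra_F
  by (meson finite_imageI)

end

end

theory Submission
  imports Defs
begin

text \<open>
  Only the outermost step needs a construction. Deleting the top and bottom of \<open>S\<^sub>n[L]\<close> leaves
  \<open>S\<^sub>n\<^sub>-\<^sub>2[L]\<close>, so \<open>S\<^sub>n[L]\<close> is \<open>S\<^sub>3[S\<^sub>n\<^sub>-\<^sub>2[L]]\<close> (\<open>sugihara_nest_Suc\<close>), and
  the theorem follows by induction once \<open>S\<^sub>3[M]\<close> is represented for every represented \<open>M\<close>.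

  Let \<open>M\<close> be embedded by \<open>h\<close> into the algebra of a frame \<open>(X, \<le>, E, \<alpha>, \<beta>)\<close>. The new top and
  bottom should become the full equivalence and the empty relation. Since \<open>\<top> \<cdot> m = \<top>\<close> must hold
  even if \<open>h m\<close> is empty, each block of \<open>E\<close> receives four new points: a two-element
  antichain below the block and another one above it. An up-set \<open>R\<close> is extended to the relation
  that is \<open>R\<close> on the old points, the identity on each antichain, and relates every point to all
  points of a higher layer of its block. Composing the full relation with such an extension gives
  the full relation again, because every point is reached from a lower cap or is one. The extended
  automorphism flips each antichain, and the extended involution exchanges the lower and the upper
  antichain. The flip is what makes the extension commute with the negations: an antichain of two
  points with the flip represents \<open>S\<^sub>3\<close>, where the identity is its own negation.

  One further block without old points is added. It keeps the images of the top, of the bottom and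
  of \<open>M\<close> distinct even when \<open>X\<close> is empty. The four new points of a block are labelled by an old
  point that represents it, so \<open>5|X| + 4\<close> points suffice for the new poset: it is finite if \<open>X\<close> is, and it fits into any infinite
  type that contains \<open>X\<close>.

  That the nested sum satisfies the axioms at all comes from the embedding: the algebra of all
  up-sets satisfies them (\<open>Dq_DqRA\<close>), and they are inherited along injective homomorphisms
  (\<open>DqRA_embedding\<close>).
\<close>

section \<open>The algebra of up-sets of a frame\<close>

locale dq_structure =
  fixes X :: "'x set" and leX E :: "'x rel" and \<alpha> \<beta> :: "'x \<Rightarrow> 'x"
  assumes frame: "dq_frame X leX E \<alpha> \<beta>"
begin

abbreviation A where "A \<equiv> Dq X leX E \<alpha> \<beta>"

lemma E_equiv: "equiv X E"
  using frame by (simp add: dq_frame_def)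

lemma E_mem: "(x, y) \<in> E \<Longrightarrow> x \<in> X" "(x, y) \<in> E \<Longrightarrow> y \<in> X"
  using E_equiv by (auto simp: equiv_def)

lemma E_refl: "x \<in> X \<Longrightarrow> (x, x) \<in> E"
  using E_equiv by (auto simp: equiv_def refl_on_def)

lemma E_sym: "(x, y) \<in> E \<Longrightarrow> (y, x) \<in> E"
  using E_equiv by (auto simp: equiv_def sym_def)

lemma E_trans: "(x, y) \<in> E \<Longrightarrow> (y, z) \<in> E \<Longrightarrow> (x, z) \<in> E"
  using E_equiv unfolding equiv_def trans_def by blast

lemma le_E: "(x, y) \<in> leX \<Longrightarrow> (x, y) \<in> E"
  using frame by (auto simp: dq_frame_def)

lemma E_le: "(y, x) \<in> E \<Longrightarrow> (y, v) \<in> leX \<Longrightarrow> (u, x) \<in> leX \<Longrightarrow> (v, u) \<in> E"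
  by (blast intro: E_trans E_sym le_E)

lemma le_refl: "x \<in> X \<Longrightarrow> (x, x) \<in> leX"
  using frame by (auto simp: dq_frame_def order_on_defs refl_on_def)

lemma le_trans: "(x, y) \<in> leX \<Longrightarrow> (y, z) \<in> leX \<Longrightarrow> (x, z) \<in> leX"
  using frame unfolding dq_frame_def order_on_defs trans_def by blast

lemma le_antisym: "(x, y) \<in> leX \<Longrightarrow> (y, x) \<in> leX \<Longrightarrow> x = y"
  using frame unfolding dq_frame_def order_on_defs antisym_def by blast

lemma bij_\<alpha>: "bij_betw \<alpha> X X" and bij_\<beta>: "bij_betw \<beta> X X"
  using frame unfolding dq_frame_def order_automorphism_def dual_order_automorphism_def by blast+

lemma \<alpha>_mem [simp]: "x \<in> X \<Longrightarrow> \<alpha> x \<in> X" and \<beta>_mem [simp]: "x \<in> X \<Longrightarrow> \<beta> x \<in> X"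
  using bij_\<alpha> bij_\<beta> by (auto simp: bij_betw_def)

lemma \<alpha>_eq: "x \<in> X \<Longrightarrow> y \<in> X \<Longrightarrow> \<alpha> x = \<alpha> y \<longleftrightarrow> x = y"
  using bij_\<alpha> by (metis bij_betw_def inj_on_eq_iff)

lemma \<alpha>_surjE: assumes "y \<in> X" obtains x where "x \<in> X" "y = \<alpha> x"
  using bij_\<alpha> assms unfolding bij_betw_def by blast

lemma \<beta>_\<beta> [simp]: "x \<in> X \<Longrightarrow> \<beta> (\<beta> x) = x"
  using frame unfolding dq_frame_def by blast

lemma \<alpha>_E: "x \<in> X \<Longrightarrow> (x, \<alpha> x) \<in> E" and \<beta>_E: "x \<in> X \<Longrightarrow> (x, \<beta> x) \<in> E"
  using frame unfolding dq_frame_def graph_on_def by blast+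

lemma \<alpha>_le: "x \<in> X \<Longrightarrow> y \<in> X \<Longrightarrow> (\<alpha> x, \<alpha> y) \<in> leX \<longleftrightarrow> (x, y) \<in> leX"
  using frame unfolding dq_frame_def order_automorphism_def by blast

lemma \<beta>_le: "x \<in> X \<Longrightarrow> y \<in> X \<Longrightarrow> (\<beta> x, \<beta> y) \<in> leX \<longleftrightarrow> (y, x) \<in> leX"
  using frame unfolding dq_frame_def dual_order_automorphism_def by blast

lemma \<alpha>_\<beta>_\<alpha>: assumes "x \<in> X" shows "\<alpha> (\<beta> (\<alpha> x)) = \<beta> x"
proof -
  have "graph_on X \<beta> = graph_on X \<alpha> O graph_on X \<beta> O graph_on X \<alpha>"
    using frame unfolding dq_frame_def by blast
  moreover have "(x, \<beta> x) \<in> graph_on X \<beta>"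
    using assms by (auto simp: graph_on_def)
  ultimately have "(x, \<beta> x) \<in> graph_on X \<alpha> O graph_on X \<beta> O graph_on X \<alpha>"
    by simp
  then show ?thesis by (auto simp: graph_on_def)
qed

lemma E_\<alpha>_left: "x \<in> X \<Longrightarrow> (\<alpha> x, y) \<in> E \<longleftrightarrow> (x, y) \<in> E"
  and E_\<alpha>_right: "y \<in> X \<Longrightarrow> (x, \<alpha> y) \<in> E \<longleftrightarrow> (x, y) \<in> E"
  and E_\<beta>_left: "x \<in> X \<Longrightarrow> (\<beta> x, y) \<in> E \<longleftrightarrow> (x, y) \<in> E"
  and E_\<beta>_right: "y \<in> X \<Longrightarrow> (x, \<beta> y) \<in> E \<longleftrightarrow> (x, y) \<in> E"
  using \<alpha>_E \<beta>_E by (blast intro: E_trans E_sym)+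

lemmas E_maps = E_\<alpha>_left E_\<alpha>_right E_\<beta>_left E_\<beta>_right

lemma up_E: "R \<in> carrier A \<Longrightarrow> (x, y) \<in> R \<Longrightarrow> (x, y) \<in> E"
  by (auto simp: Dq_def up_sets_def)

lemma up_mono:
  assumes R: "R \<in> carrier A" and xy: "(x, y) \<in> R" and le: "(u, x) \<in> leX" "(y, v) \<in> leX"
  shows "(u, v) \<in> R"
proof -
  have "(u, v) \<in> E"
    using le_E[OF le(1)] up_E[OF R xy] le_E[OF le(2)] by (blast intro: E_trans)
  with R xy le show ?thesis
    by (force simp: Dq_def up_sets_def pair_le_def)
qed

lemma upI:
  assumes "\<And>x y. (x, y) \<in> R \<Longrightarrow> (x, y) \<in> E"
    and "\<And>x y u v. (x, y) \<in> R \<Longrightarrow> (u, x) \<in> leX \<Longrightarrow> (y, v) \<in> leX \<Longrightarrow> (u, v) \<in> R"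
  shows "R \<in> carrier A"
  using assms by (fastforce simp: Dq_def up_sets_def pair_le_def)

lemma Dq_simps [simp]:
  "mult A R S = R O S" "one A = leX" "wedge A R S = R \<inter> S" "vee A R S = R \<union> S"
  by (simp_all add: Dq_def)

lemma qle_A [simp]: "qle A R S \<longleftrightarrow> R \<subseteq> S"
  by (auto simp: qle_def)

text \<open>Since \<open>\<alpha>\<close> is a bijection of \<open>X\<close>, a relation inside \<open>E\<close> is determined by its pairs of the
  form \<open>(x, \<alpha> y)\<close>; in these coordinates \<open>\<sim>\<close> needs no inverse of \<open>\<alpha>\<close>.\<close>

lemma lneg_mem: "x \<in> X \<Longrightarrow> y \<in> X \<Longrightarrow> (x, \<alpha> y) \<in> lneg A R \<longleftrightarrow> (y, x) \<in> E \<and> (y, x) \<notin> R"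
  by (auto simp: Dq_def graph_on_def relcomp_unfold \<alpha>_eq dest: E_mem)

lemma rneg_mem: "(x, y) \<in> rneg A R \<longleftrightarrow> x \<in> X \<and> (y, \<alpha> x) \<in> E \<and> (y, \<alpha> x) \<notin> R"
  by (auto simp: Dq_def graph_on_def relcomp_unfold)

lemma zero_mem: "(x, y) \<in> zero A \<longleftrightarrow> x \<in> X \<and> (y, \<alpha> x) \<in> E \<and> (y, \<alpha> x) \<notin> leX"
  by (auto simp: Dq_def graph_on_def relcomp_unfold)

lemma qneg_mem:
  "(x, y) \<in> qneg A R \<longleftrightarrow> x \<in> X \<and> y \<in> X \<and> (x, y) \<in> E \<and> (\<beta> (\<alpha> x), \<beta> y) \<notin> R"
proof -
  have "(x, y) \<in> qneg A R \<longleftrightarrow> x \<in> X \<and> (\<exists>z\<in>X. y = \<beta> z \<and> (\<beta> (\<alpha> x), z) \<in> E \<and> (\<beta> (\<alpha> x), z) \<notin> R)"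
    by (auto simp: Dq_def graph_on_def relcomp_unfold)
  then show ?thesis
    by (smt (verit) E_maps \<alpha>_mem \<beta>_mem \<beta>_\<beta>)
qed

lemma lneg_E: "(x, y) \<in> lneg A R \<Longrightarrow> (x, y) \<in> E"
  and rneg_E: "(x, y) \<in> rneg A R \<Longrightarrow> (x, y) \<in> E"
  and qneg_E: "(x, y) \<in> qneg A R \<Longrightarrow> (x, y) \<in> E"
  and zero_E: "(x, y) \<in> zero A \<Longrightarrow> (x, y) \<in> E"
proof -
  show "(x, y) \<in> lneg A R \<Longrightarrow> (x, y) \<in> E"
    by (auto simp: Dq_def graph_on_def relcomp_unfold E_maps dest: E_mem intro: E_sym)
qed (auto simp: rneg_mem qneg_mem zero_mem E_maps intro: E_sym)

lemma rel_eqI: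
  assumes "\<And>x y. (x, y) \<in> R \<Longrightarrow> (x, y) \<in> E" "\<And>x y. (x, y) \<in> S \<Longrightarrow> (x, y) \<in> E"
    and "\<And>x y. x \<in> X \<Longrightarrow> y \<in> X \<Longrightarrow> (x, y) \<in> E \<Longrightarrow> (x, \<alpha> y) \<in> R \<longleftrightarrow> (x, \<alpha> y) \<in> S"
  shows "R = S"
proof -
  have "(x, y) \<in> R \<longleftrightarrow> (x, y) \<in> S" if "(x, y) \<in> E" for x y
    using assms(3) that E_mem[OF that] by (metis E_maps(2) \<alpha>_surjE)
  then show ?thesis using assms(1,2) by auto
qed

lemma lneg_closed: assumes R: "R \<in> carrier A" shows "lneg A R \<in> carrier A"
proof (rule upI)
  fix x y u v assume xy: "(x, y) \<in> lneg A R" and le: "(u, x) \<in> leX" "(y, v) \<in> leX"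
  have mem: "x \<in> X" "y \<in> X" "u \<in> X" "v \<in> X"
    using le by (auto dest: le_E E_mem)
  obtain y' v' where y': "y' \<in> X" "y = \<alpha> y'" and v': "v' \<in> X" "v = \<alpha> v'"
    using mem by (metis \<alpha>_surjE)
  have "(y', x) \<in> E" "(y', x) \<notin> R"
    using xy mem y' by (simp_all add: lneg_mem)
  moreover have "(y', v') \<in> leX"
    using le y' v' by (simp add: \<alpha>_le)
  ultimately have "(v', u) \<in> E" "(v', u) \<notin> R"
    using E_le le(1) up_mono[OF R, of v' u y' x] by blast+
  then show "(u, v) \<in> lneg A R"
    using mem v' by (simp add: lneg_mem)
qed (rule lneg_E)

lemma rneg_closed: assumes R: "R \<in> carrier A" shows "rneg A R \<in> carrier A"
proof (rule upI)
  fix x y u v assume xy: "(x, y) \<in> rneg A R" and le: "(u, x) \<in> leX" "(y, v) \<in> leX"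
  have mem: "x \<in> X" "y \<in> X" "u \<in> X" "v \<in> X"
    using le by (auto dest: le_E E_mem)
  have "(\<alpha> u, \<alpha> x) \<in> leX"
    using le mem by (simp add: \<alpha>_le)
  moreover have "(y, \<alpha> x) \<in> E" "(y, \<alpha> x) \<notin> R"
    using xy by (simp_all add: rneg_mem)
  ultimately have "(v, \<alpha> u) \<in> E" "(v, \<alpha> u) \<notin> R"
    using E_le le(2) up_mono[OF R, of v "\<alpha> u" y "\<alpha> x"] by blast+
  then show "(u, v) \<in> rneg A R"
    using mem by (simp add: rneg_mem)
qed (rule rneg_E)

lemma qneg_closed: assumes R: "R \<in> carrier A" shows "qneg A R \<in> carrier A"
proof (rule upI)
  fix x y u v assume xy: "(x, y) \<in> qneg A R" and le: "(u, x) \<in> leX" "(y, v) \<in> leX"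
  have mem: "x \<in> X" "y \<in> X" "u \<in> X" "v \<in> X"
    using le by (auto dest: le_E E_mem)
  have "(\<beta> (\<alpha> x), \<beta> (\<alpha> u)) \<in> leX" "(\<beta> v, \<beta> y) \<in> leX"
    using le mem by (simp_all add: \<alpha>_le \<beta>_le)
  moreover have "(x, y) \<in> E" "(\<beta> (\<alpha> x), \<beta> y) \<notin> R"
    using xy by (simp_all add: qneg_mem)
  moreover have "(u, v) \<in> E"
    using E_trans[OF le_E[OF le(1)] E_trans[OF \<open>(x, y) \<in> E\<close> le_E[OF le(2)]]] .
  ultimately have "(u, v) \<in> E" "(\<beta> (\<alpha> u), \<beta> v) \<notin> R"
    using up_mono[OF R, of "\<beta> (\<alpha> u)" "\<beta> v" "\<beta> (\<alpha> x)" "\<beta> y"] by blast+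
  then show "(u, v) \<in> qneg A R"
    using mem by (simp add: qneg_mem)
qed (rule qneg_E)

lemma comp_closed: assumes "R \<in> carrier A" "S \<in> carrier A" shows "R O S \<in> carrier A"
proof (rule upI)
  fix x y u v assume "(x, y) \<in> R O S" and le: "(u, x) \<in> leX" "(y, v) \<in> leX"
  then obtain z where z: "(x, z) \<in> R" "(z, y) \<in> S" by blast
  have "(z, z) \<in> leX"
    using up_E[OF assms(1) z(1)] by (blast intro: le_refl E_mem)
  then have "(u, z) \<in> R" "(z, v) \<in> S"
    using assms z le by (blast intro: up_mono)+
  then show "(u, v) \<in> R O S" by blast
qed (use assms in \<open>blast intro: E_trans up_E\<close>)

lemma le_closed: "leX \<in> carrier A"
  by (rule upI) (blast intro: le_E le_trans)+

lemma zero_rneg: "zero A = rneg A leX"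
  by (simp add: Dq_def)

text \<open>That \<open>\<sim>1\<close> and \<open>-1\<close> coincide is the statement that \<open>\<alpha>\<close> is an order automorphism.\<close>

lemma zero_lneg: "zero A = lneg A leX"
  by (rule rel_eqI[OF zero_E lneg_E])
    (auto simp: zero_mem lneg_mem \<alpha>_le E_maps intro: E_sym)

lemma le_comp: assumes R: "R \<in> carrier A" shows "leX O R = R" "R O leX = R"
proof -
  have refl: "(x, x) \<in> leX \<and> (y, y) \<in> leX" if "(x, y) \<in> R" for x y
    using up_E[OF R that] by (blast intro: le_refl E_mem)
  have "(x, y) \<in> leX O R \<longleftrightarrow> (x, y) \<in> R" "(x, y) \<in> R O leX \<longleftrightarrow> (x, y) \<in> R" for x y
    using refl up_mono[OF R] by blast+
  then show "leX O R = R" "R O leX = R"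
    by (simp_all only: set_eq_iff split_paired_All simp_thms)
qed

text \<open>Both residuation laws unfold to the usual residuals of relations: with the two occurrences
  of \<open>\<alpha>\<close> cancelling, \<open>-(S \<cdot> \<sim>T)\<close> consists of the \<open>(x, y)\<close> such that \<open>(y, z) \<in> S\<close> implies
  \<open>(x, z) \<in> T\<close>, and \<open>\<sim>(-T \<cdot> R)\<close> is the mirror image.\<close>

lemma residual_right:
  assumes "R \<in> carrier A" "S \<in> carrier A" "T \<in> carrier A"
  shows "R O S \<subseteq> T \<longleftrightarrow> R \<subseteq> rneg A (S O lneg A T)"
proof -
  have "(x, y) \<in> rneg A (S O lneg A T) \<longleftrightarrow> (\<forall>z. (y, z) \<in> S \<longrightarrow> (x, z) \<in> T)"
    if xy: "(x, y) \<in> E" for x y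
  proof -
    have mem: "x \<in> X" "y \<in> X" using E_mem xy by auto
    have "(z, \<alpha> x) \<in> lneg A T \<longleftrightarrow> (x, z) \<notin> T" if "(y, z) \<in> S" for z
      using up_E[OF assms(2) that] xy by (auto simp: lneg_mem mem E_mem intro: E_trans)
    then show ?thesis
      using mem xy by (auto simp: rneg_mem E_maps intro: E_sym)
  qed
  then show ?thesis
    using up_E[OF assms(1)] by (auto 0 3)
qed

lemma residual_left:
  assumes "R \<in> carrier A" "S \<in> carrier A" "T \<in> carrier A"
  shows "R O S \<subseteq> T \<longleftrightarrow> S \<subseteq> lneg A (rneg A T O R)"
proof -
  have "(x, y) \<in> lneg A (rneg A T O R) \<longleftrightarrow> (\<forall>z. (z, x) \<in> R \<longrightarrow> (z, y) \<in> T)"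
    if xy: "(x, y) \<in> E" for x y
  proof -
    have mem: "x \<in> X" "y \<in> X" using E_mem xy by auto
    then obtain w where w: "w \<in> X" "y = \<alpha> w" by (metis \<alpha>_surjE)
    have "(w, z) \<in> rneg A T \<longleftrightarrow> (z, y) \<notin> T" if "(z, x) \<in> R" for z
      using up_E[OF assms(1) that] xy w by (auto simp: rneg_mem intro: E_trans)
    then show ?thesis
      using mem xy w by (auto simp: lneg_mem E_maps intro: E_sym)
  qed
  then show ?thesis
    using up_E[OF assms(2)] by (auto 0 3)
qed

lemma qneg_qneg: assumes R: "R \<in> carrier A" shows "qneg A (qneg A R) = R"
proof -
  have "(x, y) \<in> qneg A (qneg A R) \<longleftrightarrow> (x, y) \<in> R" for x y
    using up_E[OF R, of x y] E_mem[of x y]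
    by (auto simp: qneg_mem E_maps \<alpha>_\<beta>_\<alpha>)
  then show ?thesis by auto
qed

lemma qneg_lneg: assumes R: "R \<in> carrier A" shows "qneg A (lneg A R) = rneg A (qneg A R)"
proof (rule rel_eqI[OF qneg_E rneg_E])
  fix x y assume "x \<in> X" "y \<in> X" "(x, y) \<in> E"
  \<comment> \<open>\<open>\<beta> (\<alpha> y)\<close> is itself of the form \<open>\<alpha> w\<close>, with \<open>w = \<beta> (\<alpha> (\<alpha> y))\<close>.\<close>
  moreover have "\<beta> (\<alpha> y) = \<alpha> (\<beta> (\<alpha> (\<alpha> y)))"
    using \<open>y \<in> X\<close> by (simp add: \<alpha>_\<beta>_\<alpha>)
  ultimately show "(x, \<alpha> y) \<in> qneg A (lneg A R) \<longleftrightarrow> (x, \<alpha> y) \<in> rneg A (qneg A R)"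
    by (auto simp: qneg_mem rneg_mem lneg_mem E_maps intro: E_sym)
qed

text \<open>Up to the complements, \<open>\<not>\<close> transports a relation along the pair of maps
  \<open>(\<beta> \<circ> \<alpha>, \<beta>)\<close>. On the right-hand side the negations \<open>-\<close> turn this into transport along
  \<open>(\<beta> \<circ> \<alpha>, \<beta> \<circ> \<alpha>)\<close>, which preserves composition because \<open>\<beta> \<circ> \<alpha>\<close> is onto.\<close>

lemma qneg_mult:
  assumes R: "R \<in> carrier A" and S: "S \<in> carrier A"
  shows "qneg A (R O S) = qplus A (qneg A R) (qneg A S)"
  unfolding qplus_def Dq_simps
proof (rule rel_eqI[OF qneg_E lneg_E])
  fix x y assume *: "x \<in> X" "y \<in> X" "(x, y) \<in> E"
  have S': "(y, z) \<in> rneg A (qneg A S) \<longleftrightarrow> z \<in> X \<and> (\<beta> (\<alpha> z), \<beta> (\<alpha> y)) \<in> S" for z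
    using * up_E[OF S, of "\<beta> (\<alpha> z)" "\<beta> (\<alpha> y)"]
    by (auto simp: rneg_mem qneg_mem E_maps dest: E_mem)
  have R': "(z, x) \<in> rneg A (qneg A R) \<longleftrightarrow> z \<in> X \<and> (\<beta> (\<alpha> x), \<beta> (\<alpha> z)) \<in> R" for z
    using * up_E[OF R, of "\<beta> (\<alpha> x)" "\<beta> (\<alpha> z)"]
    by (auto simp: rneg_mem qneg_mem E_maps dest: E_mem)
  have surj: "\<exists>z\<in>X. w = \<beta> (\<alpha> z)" if "w \<in> X" for w
    using that by (metis \<alpha>_surjE \<beta>_\<beta> \<beta>_mem)
  have "(y, x) \<in> rneg A (qneg A S) O rneg A (qneg A R) \<longleftrightarrow> (\<beta> (\<alpha> x), \<beta> (\<alpha> y)) \<in> R O S"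
    unfolding relcomp_unfold mem_Collect_eq case_prod_conv S' R'
    using surj up_E[OF R] E_mem by blast
  then show "(x, \<alpha> y) \<in> qneg A (R O S) \<longleftrightarrow>
      (x, \<alpha> y) \<in> lneg A (rneg A (qneg A S) O rneg A (qneg A R))"
    using * by (auto simp: qneg_mem lneg_mem E_maps intro: E_sym)
qed

theorem Dq_DqRA: "DqRA A"
proof
  show "zero A \<in> carrier A"
    using le_closed rneg_closed zero_rneg by simp
  show "qneg A (vee A R S) = wedge A (qneg A R) (qneg A S)" for R S
    by (auto simp: qneg_mem)
  show "vee A R S \<in> carrier A" if "R \<in> carrier A" "S \<in> carrier A" for R S
    using that by (auto simp: Dq_def up_sets_def)
  show "wedge A R S \<in> carrier A" if "R \<in> carrier A" "S \<in> carrier A" for R S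
    using that by (auto simp: Dq_def up_sets_def)
  show "qle A (mult A R S) T \<longleftrightarrow> qle A R (rneg A (mult A S (lneg A T)))"
    if "R \<in> carrier A" "S \<in> carrier A" "T \<in> carrier A" for R S T
    using residual_right[OF that] by simp
  show "qle A (mult A R S) T \<longleftrightarrow> qle A S (lneg A (mult A (rneg A T) R))"
    if "R \<in> carrier A" "S \<in> carrier A" "T \<in> carrier A" for R S T
    using residual_left[OF that] by simp
qed (auto simp: comp_closed le_closed le_comp lneg_closed rneg_closed qneg_closed
    zero_rneg[symmetric] zero_lneg[symmetric] qneg_qneg qneg_lneg qneg_mult O_assoc)

end

section \<open>Embeddings\<close>

lemma DqRA_imp_closed: assumes "DqRA A" shows "subuniverse (carrier A) A"
proof -
  interpret DqRA A by fact
  show ?thesis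
    by (simp add: subuniverse_def wedge_closed vee_closed lneg_closed rneg_closed zero_closed
        qneg_closed)
qed

lemma qra_hom_comp: "f \<in> qra_hom A B \<Longrightarrow> g \<in> qra_hom B C \<Longrightarrow> g \<circ> f \<in> qra_hom A C"
  by (fastforce simp: qra_hom_def Pi_iff)

text \<open>All axioms are equations or equivalences between inequalities, and an injective homomorphism
  reflects both; \<open>\<preceq>\<close> is itself defined by an equation.\<close>

lemma DqRA_embedding:
  assumes "DqRA B" and h: "h \<in> qra_hom A B" and inj: "inj_on h (carrier A)"
    and cl: "subuniverse (carrier A) A"
  shows "DqRA A"
proof -
  interpret B: DqRA B by fact
  have hB [simp]: "h a \<in> carrier B" if "a \<in> carrier A" for a
    using h that by (auto simp: qra_hom_def)
  have hom [simp]: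
    "\<And>a b. \<lbrakk>a \<in> carrier A; b \<in> carrier A\<rbrakk> \<Longrightarrow> h (mult A a b) = mult B (h a) (h b)"
    "\<And>a b. \<lbrakk>a \<in> carrier A; b \<in> carrier A\<rbrakk> \<Longrightarrow> h (wedge A a b) = wedge B (h a) (h b)"
    "\<And>a b. \<lbrakk>a \<in> carrier A; b \<in> carrier A\<rbrakk> \<Longrightarrow> h (vee A a b) = vee B (h a) (h b)"
    "\<And>a. a \<in> carrier A \<Longrightarrow> h (lneg A a) = lneg B (h a)"
    "\<And>a. a \<in> carrier A \<Longrightarrow> h (rneg A a) = rneg B (h a)"
    "\<And>a. a \<in> carrier A \<Longrightarrow> h (qneg A a) = qneg B (h a)"
    "h (one A) = one B" "h (zero A) = zero B"
    using h by (simp_all add: qra_hom_def)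
  have cl' [simp]:
    "\<And>a b. \<lbrakk>a \<in> carrier A; b \<in> carrier A\<rbrakk> \<Longrightarrow> mult A a b \<in> carrier A"
    "\<And>a b. \<lbrakk>a \<in> carrier A; b \<in> carrier A\<rbrakk> \<Longrightarrow> wedge A a b \<in> carrier A"
    "\<And>a b. \<lbrakk>a \<in> carrier A; b \<in> carrier A\<rbrakk> \<Longrightarrow> vee A a b \<in> carrier A"
    "\<And>a. a \<in> carrier A \<Longrightarrow> lneg A a \<in> carrier A"
    "\<And>a. a \<in> carrier A \<Longrightarrow> rneg A a \<in> carrier A"
    "\<And>a. a \<in> carrier A \<Longrightarrow> qneg A a \<in> carrier A"
    "one A \<in> carrier A" "zero A \<in> carrier A"
    using cl by (simp_all add: subuniverse_def)
  have eqI: "a = b" if "h a = h b" "a \<in> carrier A" "b \<in> carrier A" for a b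
    using inj_onD[OF inj that] .
  have le: "qle A a b \<longleftrightarrow> qle B (h a) (h b)" if "a \<in> carrier A" "b \<in> carrier A" for a b
    using that eqI by (metis qle_def hom(2) cl'(2))
  show ?thesis
  proof
    show "mult A a b \<in> carrier A" if "a \<in> carrier A" "b \<in> carrier A" for a b
      using that by simp
    show "wedge A a b \<in> carrier A" if "a \<in> carrier A" "b \<in> carrier A" for a b
      using that by simp
    show "vee A a b \<in> carrier A" if "a \<in> carrier A" "b \<in> carrier A" for a b
      using that by simp
    show "lneg A a \<in> carrier A" "rneg A a \<in> carrier A" "qneg A a \<in> carrier A"
      if "a \<in> carrier A" for a
      using that by simp_all
    show "one A \<in> carrier A" "zero A \<in> carrier A" by simp_all
    show "zero A = rneg A (one A)"
      by (rule eqI) (simp_all add: B.zero_rneg)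
    show "zero A = lneg A (one A)"
      by (rule eqI) (simp_all add: B.zero_lneg)
    show "qle A (mult A a b) c \<longleftrightarrow> qle A a (rneg A (mult A b (lneg A c)))"
      if "a \<in> carrier A" "b \<in> carrier A" "c \<in> carrier A" for a b c
      using that by (simp add: le B.residual_right)
    show "qle A (mult A a b) c \<longleftrightarrow> qle A b (lneg A (mult A (rneg A c) a))"
      if "a \<in> carrier A" "b \<in> carrier A" "c \<in> carrier A" for a b c
      using that by (simp add: le B.residual_left)
    show "qneg A (mult A a b) = qplus A (qneg A a) (qneg A b)"
      if "a \<in> carrier A" "b \<in> carrier A" for a b
      by (rule eqI) (use that in \<open>simp_all add: qplus_def B.qneg_mult\<close>)
  qed (rule eqI; simp add: B.m_assoc B.wedge_commute B.vee_commute B.wedge_assoc B.vee_assoc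
      B.wedge_absorb B.vee_absorb B.qneg_qneg B.qneg_vee B.qneg_lneg B.wedge_vee_distrib;
      fail)+
qed

text \<open>Representability with the carrier of the poset made explicit, so that the representation
  and its finite version can be treated together.\<close>

definition represented_on :: "'x set \<Rightarrow> 'a qra \<Rightarrow> bool"
  where "represented_on X A \<longleftrightarrow> subuniverse (carrier A) A \<and>
    (\<exists>leX E \<alpha> \<beta> h. dq_frame X leX E \<alpha> \<beta> \<and> h \<in> qra_hom A (Dq X leX E \<alpha> \<beta>) \<and>
      inj_on h (carrier A))"

text \<open>Homomorphisms constrain the operations on the carrier alone and do not make it closed, so
  closure of the source has to be assumed for its image to be a subuniverse.\<close>

lemma iso_to_subalgebra_iff:
  assumes cl: "subuniverse (carrier A) A"
  shows "iso_to_subalgebra A (Dq X leX E \<alpha> \<beta>) \<longleftrightarrow>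
    (\<exists>h\<in>qra_hom A (Dq X leX E \<alpha> \<beta>). inj_on h (carrier A))" (is "?L \<longleftrightarrow> ?R")
proof
  assume ?L
  then obtain S h where "subuniverse S (Dq X leX E \<alpha> \<beta>)"
    and "h \<in> qra_iso A (Dq X leX E \<alpha> \<beta>\<lparr>carrier := S\<rparr>)"
    by (auto simp: iso_to_subalgebra_def)
  then have "h \<in> qra_hom A (Dq X leX E \<alpha> \<beta>)" "inj_on h (carrier A)"
    by (auto simp: qra_iso_def qra_hom_def subuniverse_def Dq_def bij_betw_def Pi_iff)
  then show ?R by blast
next
  assume ?R
  then obtain h where h: "h \<in> qra_hom A (Dq X leX E \<alpha> \<beta>)" "inj_on h (carrier A)" by blast
  have "subuniverse (h ` carrier A) (Dq X leX E \<alpha> \<beta>)"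
    using h(1) cl unfolding subuniverse_def qra_hom_def
    by (auto simp: image_iff Pi_iff) metis+
  moreover have "h \<in> qra_iso A (Dq X leX E \<alpha> \<beta>\<lparr>carrier := h ` carrier A\<rparr>)"
    using h by (auto simp: qra_iso_def qra_hom_def bij_betw_def Dq_def)
  ultimately show ?L
    by (auto simp: iso_to_subalgebra_def)
qed

lemma represented_on_iff:
  "represented_on X A \<longleftrightarrow>
    DqRA A \<and> (\<exists>leX E \<alpha> \<beta>. dq_frame X leX E \<alpha> \<beta> \<and> iso_to_subalgebra A (Dq X leX E \<alpha> \<beta>))"
proof -
  have "DqRA A" if "represented_on X A"
    using that dq_structure.Dq_DqRA DqRA_embedding
    unfolding represented_on_def dq_structure_def by blast
  moreover have "represented_on X A \<longleftrightarrow>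
      (\<exists>leX E \<alpha> \<beta>. dq_frame X leX E \<alpha> \<beta> \<and> iso_to_subalgebra A (Dq X leX E \<alpha> \<beta>))" if "DqRA A"
    unfolding represented_on_def iso_to_subalgebra_iff[OF DqRA_imp_closed[OF that]]
    using DqRA_imp_closed[OF that] by blast
  ultimately show ?thesis by blast
qed

lemma representable_iff: "representable TYPE('x) A \<longleftrightarrow> (\<exists>X :: 'x set. represented_on X A)"
  unfolding representable_def represented_on_iff by blast

lemma finitely_representable_iff:
  "finitely_representable TYPE('x) A \<longleftrightarrow> (\<exists>X :: 'x set. finite X \<and> represented_on X A)"
  unfolding finitely_representable_def represented_on_iff by blast

lemma represented_on_embedding:
  assumes "represented_on X B" and f: "f \<in> qra_hom A B" "inj_on f (carrier A)"
    and "subuniverse (carrier A) A"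
  shows "represented_on X A"
proof -
  from assms(1) obtain leX E \<alpha> \<beta> h
    where frame: "dq_frame X leX E \<alpha> \<beta>" and h: "h \<in> qra_hom B (Dq X leX E \<alpha> \<beta>)"
      and inj: "inj_on h (carrier B)"
    by (auto simp: represented_on_def)
  have "f ` carrier A \<subseteq> carrier B"
    using f(1) by (auto simp: qra_hom_def)
  then have "inj_on (h \<circ> f) (carrier A)"
    using f(2) inj by (blast intro: comp_inj_on inj_on_subset)
  with qra_hom_comp[OF f(1) h] frame assms(4) show ?thesis
    unfolding represented_on_def by blast
qed

section \<open>Nested sums of Sugihara chains\<close>

context InFL_algebra
begin

lemma wedge_idem: assumes "a \<in> carrier A" shows "a \<curlywedge> a = a"
  using wedge_absorb[of a "a \<curlywedge> a"] vee_absorb[of a a] assms by (simp add: wedge_closed)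

lemma qle_refl: "a \<in> carrier A \<Longrightarrow> a \<preceq> a"
  by (simp add: qle_def wedge_idem)

lemma qle_antisym: "a \<in> carrier A \<Longrightarrow> b \<in> carrier A \<Longrightarrow> a \<preceq> b \<Longrightarrow> b \<preceq> a \<Longrightarrow> a = b"
  using wedge_commute[of a b] by (simp add: qle_def)

lemma rneg_lneg: assumes "c \<in> carrier A" shows "\<ominus> (\<sim> c) = c"
proof -
  have "a \<preceq> c \<longleftrightarrow> a \<preceq> \<ominus> (\<sim> c)" if "a \<in> carrier A" for a
    using residual_right[of a \<one> c] that assms by (simp add: lneg_closed)
  then show ?thesis
    using assms by (meson qle_antisym qle_refl lneg_closed rneg_closed)
qed

lemma lneg_rneg: assumes "c \<in> carrier A" shows "\<sim> (\<ominus> c) = c"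
proof -
  have "a \<preceq> c \<longleftrightarrow> a \<preceq> \<sim> (\<ominus> c)" if "a \<in> carrier A" for a
    using residual_left[of \<one> a c] that assms by (simp add: rneg_closed)
  then show ?thesis
    using assms by (meson qle_antisym qle_refl lneg_closed rneg_closed)
qed

text \<open>In a nested sum the linear negations are defined by residuals of \<open>0\<close>; these two lemmas
  identify them with the original negations on the inner summand.\<close>

lemma lres_zero: "a \<in> carrier A \<Longrightarrow> lres A a \<zero> = \<sim> a"
  using rneg_lneg[OF one_closed] by (simp add: lres_def zero_lneg)

lemma rres_zero: "a \<in> carrier A \<Longrightarrow> rres A \<zero> a = \<ominus> a"
  using lneg_rneg[OF one_closed] by (simp add: rres_def zero_rneg)

end

text \<open>\<open>sugihara_nest k L\<close> is \<open>S\<^sub>2\<^sub>k\<^sub>+\<^sub>1[L]\<close>: the chain contributes \<open>k\<close> new elements below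
  and \<open>k\<close> new elements above \<open>L\<close>.\<close>

definition sugihara_nest :: "nat \<Rightarrow> 'a qra \<Rightarrow> (int + 'a) qra"
  where "sugihara_nest k L = nested_sum (sugihara (2 * k + 1)) L"

lemma sugihara_nest_simps [simp]:
  "Inl i \<in> carrier (sugihara_nest k L) \<longleftrightarrow> \<bar>i\<bar> \<le> int k \<and> i \<noteq> 0"
  "Inr l \<in> carrier (sugihara_nest k L) \<longleftrightarrow> l \<in> carrier L"
  "mult (sugihara_nest k L) (Inl i) (Inl j) =
    Inl (if \<bar>j\<bar> < \<bar>i\<bar> then i else if \<bar>i\<bar> < \<bar>j\<bar> then j else min i j)"
  "mult (sugihara_nest k L) (Inl i) (Inr l) = Inl i"
  "mult (sugihara_nest k L) (Inr l) (Inl i) = Inl i"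
  "mult (sugihara_nest k L) (Inr l) (Inr m) = Inr (mult L l m)"
  "wedge (sugihara_nest k L) (Inl i) (Inl j) = Inl (min i j)"
  "wedge (sugihara_nest k L) (Inl i) (Inr l) = (if 0 \<le> i then Inr l else Inl i)"
  "wedge (sugihara_nest k L) (Inr l) (Inl i) = (if 0 \<le> i then Inr l else Inl i)"
  "wedge (sugihara_nest k L) (Inr l) (Inr m) = Inr (wedge L l m)"
  "vee (sugihara_nest k L) (Inl i) (Inl j) = Inl (max i j)"
  "vee (sugihara_nest k L) (Inl i) (Inr l) = (if i \<le> 0 then Inr l else Inl i)"
  "vee (sugihara_nest k L) (Inr l) (Inl i) = (if i \<le> 0 then Inr l else Inl i)"
  "vee (sugihara_nest k L) (Inr l) (Inr m) = Inr (vee L l m)"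
  "lneg (sugihara_nest k L) (Inl i) = Inl (- i)"
  "rneg (sugihara_nest k L) (Inl i) = Inl (- i)"
  "qneg (sugihara_nest k L) (Inl i) = Inl (- i)"
  "qneg (sugihara_nest k L) (Inr l) = Inr (qneg L l)"
  "one (sugihara_nest k L) = Inr (one L)"
  "zero (sugihara_nest k L) = Inr (zero L)"
  by (auto simp: sugihara_nest_def nested_sum_def sugihara_def image_iff nested_mult_def nested_lres_def nested_rres_def
      lres_def rres_def qle_def)

lemma sugihara_nest_neg [simp]:
  assumes "DqRA L" "l \<in> carrier L"
  shows "lneg (sugihara_nest k L) (Inr l) = Inr (lneg L l)"
    and "rneg (sugihara_nest k L) (Inr l) = Inr (rneg L l)"
proof -
  interpret DqRA L by fact
  show "lneg (sugihara_nest k L) (Inr l) = Inr (lneg L l)"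
    "rneg (sugihara_nest k L) (Inr l) = Inr (rneg L l)"
    using assms(2)
    by (simp_all add: sugihara_nest_def nested_sum_def nested_lres_def nested_rres_def lres_zero rres_zero)
qed

lemma sugihara_nest_cases [consumes 1]:
  assumes "a \<in> carrier (sugihara_nest k L)"
  obtains i where "a = Inl i" "\<bar>i\<bar> \<le> int k" "i \<noteq> 0" | l where "a = Inr l" "l \<in> carrier L"
  using assms by (cases a) auto

lemma sugihara_nest_closed:
  assumes "DqRA L" shows "subuniverse (carrier (sugihara_nest k L)) (sugihara_nest k L)"
  using DqRA_imp_closed[OF assms] assms
  by (auto simp: subuniverse_def elim!: sugihara_nest_cases)

lemma sugihara_nest_0:
  assumes "represented_on X L" shows "represented_on X (sugihara_nest 0 L)"
proof (rule represented_on_embedding[OF assms])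
  have L: "DqRA L" using assms by (simp add: represented_on_iff)
  show "projr \<in> qra_hom (sugihara_nest 0 L) L"
    using L by (auto simp: qra_hom_def elim!: sugihara_nest_cases)
  show "inj_on projr (carrier (sugihara_nest 0 L))"
  proof (rule inj_onI)
    fix a b assume "a \<in> carrier (sugihara_nest 0 L)" "b \<in> carrier (sugihara_nest 0 L)"
      "projr a = projr b"
    then show "a = b" by (cases a; cases b) simp_all
  qed
  show "subuniverse (carrier (sugihara_nest 0 L)) (sugihara_nest 0 L)"
    using L by (rule sugihara_nest_closed)
qed

text \<open>\<open>S\<^sub>2\<^sub>k\<^sub>+\<^sub>3[L]\<close> is \<open>S\<^sub>3[S\<^sub>2\<^sub>k\<^sub>+\<^sub>1[L]]\<close>: the outermost elements of the
  longer chain become the two non-unit elements of \<open>S\<^sub>3\<close>.\<close>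

lemma sugihara_nest_Suc:
  assumes "DqRA L" "DqRA (sugihara_nest k L)" "represented_on X (sugihara_nest 1 (sugihara_nest k L))"
  shows "represented_on X (sugihara_nest (Suc k) L)"
proof (rule represented_on_embedding[OF assms(3)])
  let ?f = "\<lambda>a. case a of
      Inl i \<Rightarrow> if \<bar>i\<bar> = int (Suc k) then Inl (sgn i) else Inr (Inl i)
    | Inr l \<Rightarrow> Inr (Inr l)"
  let ?S = "sugihara_nest (Suc k) L" and ?T = "sugihara_nest 1 (sugihara_nest k L)"
  have cl: "?f a \<in> carrier ?T" if "a \<in> carrier ?S" for a
    using that by (cases a) (auto simp: sgn_if)
  have mult: "?f (mult ?S a b) = mult ?T (?f a) (?f b)"
    if "a \<in> carrier ?S" "b \<in> carrier ?S" for a b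
    using that by (cases a; cases b) (auto simp: sgn_if min_def)
  have wedge: "?f (wedge ?S a b) = wedge ?T (?f a) (?f b)"
    if "a \<in> carrier ?S" "b \<in> carrier ?S" for a b
    using that by (cases a; cases b) (auto simp: sgn_if min_def)
  have vee: "?f (vee ?S a b) = vee ?T (?f a) (?f b)"
    if "a \<in> carrier ?S" "b \<in> carrier ?S" for a b
    using that by (cases a; cases b) (auto simp: sgn_if max_def)
  have neg: "?f (lneg ?S a) = lneg ?T (?f a)" "?f (rneg ?S a) = rneg ?T (?f a)"
    "?f (qneg ?S a) = qneg ?T (?f a)" if "a \<in> carrier ?S" for a
    using that assms(1,2) by (cases a; simp add: sgn_minus)+
  show "?f \<in> qra_hom ?S ?T"
    unfolding qra_hom_def
    by (intro CollectI conjI ballI Pi_I; (rule cl mult wedge vee neg; assumption)?) simp_all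
  show "inj_on ?f (carrier (sugihara_nest (Suc k) L))"
  proof (rule inj_onI)
    fix a b
    assume "a \<in> carrier (sugihara_nest (Suc k) L)" "b \<in> carrier (sugihara_nest (Suc k) L)"
      "?f a = ?f b"
    then show "a = b" by (cases a; cases b) (auto simp: sgn_if split: if_splits)
  qed
  show "subuniverse (carrier (sugihara_nest (Suc k) L)) (sugihara_nest (Suc k) L)"
    using assms(1) by (rule sugihara_nest_closed)
qed

section \<open>Capping every block of a frame\<close>

text \<open>The lower antichain \<open>{Low i b | b}\<close> and the upper antichain \<open>{High i b | b}\<close> carry an index \<open>i\<close>,
  which is \<open>Some r\<close> for an old point \<open>r\<close> or \<open>None\<close>. If \<open>r\<close> is the chosen representative of an
  \<open>E\<close>-class, they are attached to that class; for all other indices they form a block of their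
  own, which does no harm.\<close>

datatype 'x cap = Core 'x | Low "'x option" bool | High "'x option" bool

text \<open>This relation is meant for two points of the same block, so the indices are not
  compared. The last catch-all equations express that the layers are ordered
  \<open>Low < Core < High\<close>.\<close>

fun cap_related :: "'x rel \<Rightarrow> 'x cap \<Rightarrow> 'x cap \<Rightarrow> bool" where
  "cap_related R (Core x) (Core y) \<longleftrightarrow> (x, y) \<in> R"
| "cap_related R (Low _ b) (Low _ c) \<longleftrightarrow> b = c"
| "cap_related R (High _ b) (High _ c) \<longleftrightarrow> b = c"
| "cap_related R (Low _ _) _ \<longleftrightarrow> True"
| "cap_related R _ (High _ _) \<longleftrightarrow> True"
| "cap_related R _ _ \<longleftrightarrow> False"

lemma graph_on_comp: "f ` X \<subseteq> X \<Longrightarrow> graph_on X f O graph_on X g = graph_on X (g \<circ> f)"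
  by (auto simp: graph_on_def)

lemma graph_on_cong: "(\<And>x. x \<in> X \<Longrightarrow> f x = g x) \<Longrightarrow> graph_on X f = graph_on X g"
  by (auto simp: graph_on_def)

context dq_structure
begin

text \<open>Blocks are named by representatives instead of equivalence classes in order to keep the
  cardinality of the new points at that of \<open>'x\<close>.\<close>

definition rep :: "'x \<Rightarrow> 'x" where "rep x = (SOME y. (x, y) \<in> E)"

lemma rep_E: "x \<in> X \<Longrightarrow> (x, rep x) \<in> E"
  unfolding rep_def by (rule someI) (rule E_refl)

lemma rep_mem [simp]: "x \<in> X \<Longrightarrow> rep x \<in> X"
  using rep_E E_mem by blast

lemma rep_eq [simp]: assumes "x \<in> X" "y \<in> X" shows "rep x = rep y \<longleftrightarrow> (x, y) \<in> E"
proof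
  assume "rep x = rep y"
  then show "(x, y) \<in> E"
    using rep_E[OF assms(1)] rep_E[OF assms(2)] by (metis E_sym E_trans)
next
  assume "(x, y) \<in> E"
  then have "(x, z) \<in> E \<longleftrightarrow> (y, z) \<in> E" for z
    by (blast intro: E_sym E_trans)
  then show "rep x = rep y" by (simp add: rep_def)
qed

lemma rep_maps [simp]: "x \<in> X \<Longrightarrow> rep (\<alpha> x) = rep x" "x \<in> X \<Longrightarrow> rep (\<beta> x) = rep x"
  by (simp_all add: E_maps E_refl)

primrec block :: "'x cap \<Rightarrow> 'x option" where
  "block (Core x) = Some (rep x)"
| "block (Low i b) = i"
| "block (High i b) = i"

primrec cap_\<alpha> :: "'x cap \<Rightarrow> 'x cap" where
  "cap_\<alpha> (Core x) = Core (\<alpha> x)"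
| "cap_\<alpha> (Low i b) = Low i (\<not> b)"
| "cap_\<alpha> (High i b) = High i (\<not> b)"

primrec cap_\<beta> :: "'x cap \<Rightarrow> 'x cap" where
  "cap_\<beta> (Core x) = Core (\<beta> x)"
| "cap_\<beta> (Low i b) = High i b"
| "cap_\<beta> (High i b) = Low i b"

definition cap_X :: "'x cap set" where
  "cap_X = Core ` X \<union> (\<Union>i \<in> insert None (Some ` X). range (Low i) \<union> range (High i))"

definition cap_E :: "'x cap rel" where
  "cap_E = {(p, q). p \<in> cap_X \<and> q \<in> cap_X \<and> block p = block q}"

text \<open>Applied to the order of the frame this gives the order of the capped frame, and applied to
  an up-set it gives the up-set that represents the same element there.\<close>

definition cap_rel :: "'x rel \<Rightarrow> 'x cap rel" where
  "cap_rel R = {(p, q) \<in> cap_E. cap_related R p q}"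

lemma cap_X_simps [simp]:
  "Core x \<in> cap_X \<longleftrightarrow> x \<in> X"
  "Low i b \<in> cap_X \<longleftrightarrow> i \<in> insert None (Some ` X)"
  "High i b \<in> cap_X \<longleftrightarrow> i \<in> insert None (Some ` X)"
  by (auto simp: cap_X_def image_iff)

lemma finite_cap_X: "finite X \<Longrightarrow> finite cap_X"
  by (simp add: cap_X_def)

lemma cap_E_iff [simp]: "(p, q) \<in> cap_E \<longleftrightarrow> p \<in> cap_X \<and> q \<in> cap_X \<and> block p = block q"
  by (simp add: cap_E_def)

lemma cap_rel_iff [simp]: "(p, q) \<in> cap_rel R \<longleftrightarrow> (p, q) \<in> cap_E \<and> cap_related R p q"
  by (auto simp: cap_rel_def)

lemma cap_\<alpha>_mem [simp]: "p \<in> cap_X \<Longrightarrow> cap_\<alpha> p \<in> cap_X"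
  and cap_\<beta>_mem [simp]: "p \<in> cap_X \<Longrightarrow> cap_\<beta> p \<in> cap_X"
  and block_cap_\<alpha> [simp]: "p \<in> cap_X \<Longrightarrow> block (cap_\<alpha> p) = block p"
  and block_cap_\<beta> [simp]: "p \<in> cap_X \<Longrightarrow> block (cap_\<beta> p) = block p"
  and cap_\<beta>_\<beta> [simp]: "p \<in> cap_X \<Longrightarrow> cap_\<beta> (cap_\<beta> p) = p"
  and cap_\<alpha>_\<beta>_\<alpha>: "p \<in> cap_X \<Longrightarrow> cap_\<alpha> (cap_\<beta> (cap_\<alpha> p)) = cap_\<beta> p"
  by (cases p; simp add: E_maps E_refl \<alpha>_\<beta>_\<alpha>)+

lemma cap_frame: "dq_frame cap_X (cap_rel leX) cap_E cap_\<alpha> cap_\<beta>"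
proof -
  have po: "partial_order_on cap_X (cap_rel leX)"
    unfolding order_on_defs
  proof (intro conjI)
    show "cap_rel leX \<subseteq> cap_X \<times> cap_X" by auto
    show "refl_on cap_X (cap_rel leX)"
    proof (rule refl_onI)
      fix p assume "p \<in> cap_X"
      then show "(p, p) \<in> cap_rel leX" by (cases p) (auto simp: le_refl)
    qed
    show "trans (cap_rel leX)"
    proof (rule transI)
      fix p q r assume "(p, q) \<in> cap_rel leX" "(q, r) \<in> cap_rel leX"
      then show "(p, r) \<in> cap_rel leX"
        by (cases p; cases q; cases r) (auto intro: le_trans)
    qed
    show "antisym (cap_rel leX)"
    proof (rule antisymI)
      fix p q assume "(p, q) \<in> cap_rel leX" "(q, p) \<in> cap_rel leX"
      then show "p = q" by (cases p; cases q) (auto intro: le_antisym)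
    qed
  qed
  have eq: "equiv cap_X cap_E"
    by (rule equivI) (auto simp: refl_on_def sym_def trans_def)
  have inj_\<alpha>: "inj_on cap_\<alpha> cap_X"
  proof (rule inj_onI)
    fix p q assume "p \<in> cap_X" "q \<in> cap_X" "cap_\<alpha> p = cap_\<alpha> q"
    then show "p = q" by (cases p; cases q) (auto simp: \<alpha>_eq)
  qed
  have surj_\<alpha>: "p \<in> cap_\<alpha> ` cap_X" if p: "p \<in> cap_X" for p
  proof (cases p)
    case (Core x)
    then obtain y where "y \<in> X" "x = \<alpha> y" using p \<alpha>_surjE[of x] by auto
    then show ?thesis using Core by (auto intro!: image_eqI[of _ _ "Core y"])
  next
    case (Low i b)
    then show ?thesis using p by (auto intro!: image_eqI[of _ _ "Low i (\<not> b)"])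
  next
    case (High i b)
    then show ?thesis using p by (auto intro!: image_eqI[of _ _ "High i (\<not> b)"])
  qed
  have le_\<alpha>: "(p, q) \<in> cap_rel leX \<longleftrightarrow> (cap_\<alpha> p, cap_\<alpha> q) \<in> cap_rel leX"
    if "p \<in> cap_X" "q \<in> cap_X" for p q
    using that by (cases p; cases q) (simp_all add: \<alpha>_le E_maps)
  have le_\<beta>: "(p, q) \<in> cap_rel leX \<longleftrightarrow> (cap_\<beta> q, cap_\<beta> p) \<in> cap_rel leX"
    if "p \<in> cap_X" "q \<in> cap_X" for p q
    using that by (cases p; cases q) (auto simp: \<beta>_le E_maps intro: E_sym)
  have bij_\<alpha>: "bij_betw cap_\<alpha> cap_X cap_X"
    using inj_\<alpha> surj_\<alpha> by (auto simp: bij_betw_def)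
  have bij_\<beta>: "bij_betw cap_\<beta> cap_X cap_X"
    by (rule bij_betw_byWitness[of _ cap_\<beta>]) auto
  have graphs: "graph_on cap_X cap_\<beta> =
      graph_on cap_X cap_\<alpha> O graph_on cap_X cap_\<beta> O graph_on cap_X cap_\<alpha>"
    by (simp add: graph_on_comp image_subset_iff)
      (auto intro!: graph_on_cong simp: cap_\<alpha>_\<beta>_\<alpha>)
  have sub: "cap_rel leX \<subseteq> cap_E" "graph_on cap_X cap_\<alpha> \<subseteq> cap_E" "graph_on cap_X cap_\<beta> \<subseteq> cap_E"
    by (auto simp: graph_on_def)
  show ?thesis
    unfolding dq_frame_def order_automorphism_def dual_order_automorphism_def
    by (intro conjI ballI po eq bij_\<alpha> bij_\<beta> graphs sub le_\<alpha> le_\<beta> cap_\<beta>_\<beta>)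
qed

interpretation cap: dq_structure cap_X "cap_rel leX" cap_E cap_\<alpha> cap_\<beta>
  by (rule dq_structure.intro, rule cap_frame)

lemma cap_rel_closed: assumes R: "R \<in> carrier A" shows "cap_rel R \<in> carrier cap.A"
proof (rule cap.upI)
  fix p q u v assume "(p, q) \<in> cap_rel R" "(u, p) \<in> cap_rel leX" "(q, v) \<in> cap_rel leX"
  then show "(u, v) \<in> cap_rel R"
    by (cases p; cases q; cases u; cases v) (auto intro: up_mono[OF R])
qed simp

lemma cap_E_closed: "cap_E \<in> carrier cap.A" "{} \<in> carrier cap.A"
  by (rule cap.upI; simp)+

lemma cap_rel_Int: "cap_rel (R \<inter> S) = cap_rel R \<inter> cap_rel S"
proof -
  have "cap_related (R \<inter> S) p q \<longleftrightarrow> cap_related R p q \<and> cap_related S p q" for p q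
    by (cases p; cases q) auto
  then show ?thesis by (auto simp: cap_rel_def)
qed

lemma cap_rel_Un: "cap_rel (R \<union> S) = cap_rel R \<union> cap_rel S"
proof -
  have "cap_related (R \<union> S) p q \<longleftrightarrow> cap_related R p q \<or> cap_related S p q" for p q
    by (cases p; cases q) auto
  then show ?thesis by (auto simp: cap_rel_def)
qed

text \<open>A pair of old points in the composite cannot pass through a cap, since nothing leads from
  a core point down to a lower cap or from an upper cap back to the core. A pair starting in a
  lower cap or ending in an upper cap needs no old point as an intermediate, because caps are
  related to themselves.\<close>

lemma cap_rel_comp:
  assumes "R \<subseteq> E"
  shows "cap_rel (R O S) = cap_rel R O cap_rel S"
proof -
  have "(p, q) \<in> cap_rel (R O S) \<longleftrightarrow> (p, q) \<in> cap_rel R O cap_rel S" for p q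
  proof
    assume L: "(p, q) \<in> cap_rel (R O S)"
    consider x y where "p = Core x" "q = Core y" | i b where "p = Low i b" | j c where "q = High j c"
      using L by (cases p; cases q) auto
    then show "(p, q) \<in> cap_rel R O cap_rel S"
    proof cases
      case 1
      then obtain z where "(x, z) \<in> R" "(z, y) \<in> S" using L by auto
      moreover have "(x, z) \<in> E" using assms \<open>(x, z) \<in> R\<close> by blast
      moreover have "(z, y) \<in> E"
        using L 1 E_trans[OF E_sym[OF \<open>(x, z) \<in> E\<close>]] by auto
      ultimately have "(Core x, Core z) \<in> cap_rel R" "(Core z, Core y) \<in> cap_rel S"
        using L 1 E_mem[of x z] by (auto intro: E_sym)
      then show ?thesis using 1 by blast
    next
      case 2
      have "(p, p) \<in> cap_rel R" "(p, q) \<in> cap_rel S"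
        using L 2 by (cases q; auto)+
      then show ?thesis by blast
    next
      case 3
      have "(p, q) \<in> cap_rel R" "(q, q) \<in> cap_rel S"
        using L 3 by (cases p; auto)+
      then show ?thesis by blast
    qed
  next
    assume "(p, q) \<in> cap_rel R O cap_rel S"
    then obtain r where "(p, r) \<in> cap_rel R" "(r, q) \<in> cap_rel S" by blast
    then show "(p, q) \<in> cap_rel (R O S)"
      by (cases p; cases q; cases r) auto
  qed
  then show ?thesis by (simp only: set_eq_iff split_paired_All simp_thms)
qed

text \<open>Between different layers exactly one direction is related, and this survives complementing
  and transposing. On an antichain \<open>{c, d}\<close> flipped by \<open>\<alpha>\<close>, complementing turns the identity into
  the flip, which \<open>\<alpha>\<close> turns back into the identity. The same computation settles the other two
  negations, where for \<open>\<not>\<close> the exchange of the layers by \<open>\<beta>\<close> does the transposing.\<close>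

lemma cap_rel_lneg: "cap_rel (lneg A R) = lneg cap.A (cap_rel R)"
proof (rule cap.rel_eqI[OF _ cap.lneg_E])
  fix p q assume pq: "p \<in> cap_X" "q \<in> cap_X" "(p, q) \<in> cap_E"
  then show "(p, cap_\<alpha> q) \<in> cap_rel (lneg A R) \<longleftrightarrow> (p, cap_\<alpha> q) \<in> lneg cap.A (cap_rel R)"
    unfolding cap.lneg_mem[OF pq(1,2)]
    by (cases p; cases q) (auto simp: lneg_mem E_maps intro: E_sym)
qed simp

lemma cap_rel_rneg: "cap_rel (rneg A R) = rneg cap.A (cap_rel R)"
proof -
  have "(p, q) \<in> cap_rel (rneg A R) \<longleftrightarrow> (p, q) \<in> rneg cap.A (cap_rel R)" for p q
    by (cases p; cases q) (auto simp: cap.rneg_mem rneg_mem E_maps intro: E_sym)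
  then show ?thesis by (simp only: set_eq_iff split_paired_All simp_thms)
qed

lemma cap_rel_qneg: "cap_rel (qneg A R) = qneg cap.A (cap_rel R)"
proof -
  have "(p, q) \<in> cap_rel (qneg A R) \<longleftrightarrow> (p, q) \<in> qneg cap.A (cap_rel R)" for p q
    by (cases p; cases q) (auto simp: cap.qneg_mem qneg_mem E_maps)
  then show ?thesis by (simp only: set_eq_iff split_paired_All simp_thms)
qed

lemma cap_rel_zero: "zero cap.A = cap_rel (zero A)"
  by (simp only: zero_lneg cap.zero_lneg cap_rel_lneg)

lemma cap_rel_inject:
  assumes "R \<subseteq> E" "S \<subseteq> E" "cap_rel R = cap_rel S" shows "R = S"
proof -
  have "(x, y) \<in> R \<longleftrightarrow> (x, y) \<in> S" if "(x, y) \<in> E" for x y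
  proof -
    have "(Core x, Core y) \<in> cap_E" using that E_mem by auto
    then have "(Core x, Core y) \<in> cap_rel R \<longleftrightarrow> (x, y) \<in> R"
      "(Core x, Core y) \<in> cap_rel S \<longleftrightarrow> (x, y) \<in> S" by auto
    then show ?thesis using assms(3) by simp
  qed
  then show ?thesis using assms(1,2) by auto
qed

lemma block_mem: "p \<in> cap_X \<Longrightarrow> block p \<in> insert None (Some ` X)"
  by (cases p) auto

text \<open>These equations say \<open>\<top> \<cdot> m = m \<cdot> \<top> = \<top>\<close> and are the reason for the caps: a full relation
  can go down to a lower cap before the extension of \<open>R\<close> is applied, and a lower cap is related to
  itself and to all higher layers without any pair of \<open>R\<close>. Upper caps play this part on the other
  side.\<close>

lemma cap_E_comp: "cap_E O cap_rel R = cap_E" "cap_rel R O cap_E = cap_E" "cap_E O cap_E = cap_E"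
proof -
  have "(p, q) \<in> cap_E O cap_rel R" if pq: "(p, q) \<in> cap_E" for p q
  proof (cases "\<exists>i b. q = Low i b")
    case True
    then have "(q, q) \<in> cap_rel R" using pq by auto
    then show ?thesis using pq by blast
  next
    case False
    then show ?thesis
      using pq block_mem[of q]
      by (cases q) (auto intro!: relcompI[of _ "Low (block q) False"]
          relcompI[of _ "Low (block q) True"])
  qed
  then show "cap_E O cap_rel R = cap_E" by auto
  have "(p, q) \<in> cap_rel R O cap_E" if pq: "(p, q) \<in> cap_E" for p q
  proof (cases "\<exists>i b. p = High i b")
    case True
    then have "(p, p) \<in> cap_rel R" using pq by auto
    then show ?thesis using pq by blast
  next
    case False
    then show ?thesis
      using pq block_mem[of p]
      by (cases p) (auto intro!: relcompI[of _ "High (block p) False"])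
  qed
  then show "cap_rel R O cap_E = cap_E" by auto
  show "cap_E O cap_E = cap_E"
    by auto
qed

lemma cap_E_neg:
  "lneg cap.A cap_E = {}" "rneg cap.A cap_E = {}" "qneg cap.A cap_E = {}"
  "lneg cap.A {} = cap_E" "rneg cap.A {} = cap_E" "qneg cap.A {} = cap_E"
proof -
  show "lneg cap.A cap_E = {}" "lneg cap.A {} = cap_E"
    by (rule cap.rel_eqI[OF cap.lneg_E]; auto simp: cap.lneg_mem)+
qed (auto simp: cap.rneg_mem cap.qneg_mem)

text \<open>The witnesses come from the extra block \<open>None\<close>, which exists even if \<open>X\<close> is empty.\<close>

lemma cap_rel_proper: "cap_rel R \<noteq> {}" "cap_rel R \<noteq> cap_E"
proof -
  have "(Low None True, Low None True) \<in> cap_rel R" "(High None True, Low None True) \<notin> cap_rel R"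
    "(High None True, Low None True) \<in> cap_E"
    by simp_all
  then show "cap_rel R \<noteq> {}" "cap_rel R \<noteq> cap_E" by blast+
qed

lemma represented_on_cap:
  assumes M: "DqRA M" and h: "h \<in> qra_hom M A" and inj: "inj_on h (carrier M)"
  shows "represented_on cap_X (sugihara_nest 1 M)"
proof -
  let ?f = "\<lambda>a. case a of Inl i \<Rightarrow> if 0 < i then cap_E else {} | Inr l \<Rightarrow> cap_rel (h l)"
  let ?S = "sugihara_nest 1 M"
  have hE: "h l \<subseteq> E" and hA: "h l \<in> carrier A" if "l \<in> carrier M" for l
    using h that up_E by (auto simp: qra_hom_def)
  have one: "h (one M) = leX" and zero: "h (zero M) = zero A"
    using h by (simp_all add: qra_hom_def)
  have bin: "h (mult M a b) = h a O h b" "h (wedge M a b) = h a \<inter> h b"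
    "h (vee M a b) = h a \<union> h b" if "a \<in> carrier M" "b \<in> carrier M" for a b
    using h that by (simp_all add: qra_hom_def)
  have un: "h (lneg M a) = lneg A (h a)" "h (rneg M a) = rneg A (h a)"
    "h (qneg M a) = qneg A (h a)" if "a \<in> carrier M" for a
    using h that by (simp_all add: qra_hom_def)
  have sub: "cap_rel R \<subseteq> cap_E" for R by auto
  have cl: "?f a \<in> carrier cap.A" if "a \<in> carrier ?S" for a
    using that by (cases a) (simp_all add: cap_E_closed cap_rel_closed hA)
  have int: "i = 1 \<or> i = -1" if "\<bar>i\<bar> \<le> 1" "i \<noteq> 0" for i :: int
    using that by auto
  have mult: "?f (mult ?S a b) = ?f a O ?f b"
    if "a \<in> carrier ?S" "b \<in> carrier ?S" for a b
    using that by (cases a; cases b)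
      (auto dest!: int simp: cap_E_comp bin cap_rel_comp hE simp del: cap_E_iff cap_rel_iff)
  have wedge: "?f (wedge ?S a b) = ?f a \<inter> ?f b"
    if "a \<in> carrier ?S" "b \<in> carrier ?S" for a b
    using that sub by (cases a; cases b)
      (auto dest!: int simp: bin cap_rel_Int)
  have vee: "?f (vee ?S a b) = ?f a \<union> ?f b"
    if "a \<in> carrier ?S" "b \<in> carrier ?S" for a b
    using that sub by (cases a; cases b)
      (auto dest!: int simp: bin cap_rel_Un)
  have neg: "?f (lneg ?S a) = lneg cap.A (?f a)" "?f (rneg ?S a) = rneg cap.A (?f a)"
    "?f (qneg ?S a) = qneg cap.A (?f a)" if "a \<in> carrier ?S" for a
    using that M
    by (cases a; auto dest!: int simp: un cap_rel_lneg cap_rel_rneg cap_rel_qneg cap_E_neg)+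
  have "?f \<in> qra_hom ?S cap.A"
    unfolding qra_hom_def cap.Dq_simps
    by (intro CollectI conjI ballI Pi_I; (rule cl mult wedge vee neg; assumption)?)
      (simp_all add: one zero cap_rel_zero)
  moreover have "inj_on ?f (carrier ?S)"
  proof (rule inj_onI)
    fix a b assume ab: "a \<in> carrier ?S" "b \<in> carrier ?S" "?f a = ?f b"
    have "(High None True, Low None True) \<in> cap_E" by simp
    then have "cap_E \<noteq> {}" by blast
    moreover have "l = m" if "cap_rel (h l) = cap_rel (h m)" "l \<in> carrier M" "m \<in> carrier M" for l m
      using cap_rel_inject[OF hE hE] inj_onD[OF inj] that by blast
    ultimately show "a = b"
      using ab cap_rel_proper cap_rel_proper[symmetric]
      by (cases a; cases b) (auto dest!: int split: if_splits simp del: cap_E_iff cap_rel_iff)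
  qed
  ultimately show ?thesis
    unfolding represented_on_def using cap_frame sugihara_nest_closed[OF M] by blast
qed

end

lemma represented_on_sugihara_nest_1:
  fixes X :: "'x set"
  assumes "represented_on X M"
  obtains X' :: "'x cap set"
  where "represented_on X' (sugihara_nest 1 M)" "finite X \<Longrightarrow> finite X'"
proof -
  from assms obtain leX E \<alpha> \<beta> h where frame: "dq_frame X leX E \<alpha> \<beta>"
    and h: "h \<in> qra_hom M (Dq X leX E \<alpha> \<beta>)" "inj_on h (carrier M)"
    by (auto simp: represented_on_def)
  interpret dq_structure X leX E \<alpha> \<beta> by (rule dq_structure.intro) fact
  show ?thesis
  proof (rule that)
    show "represented_on cap_X (sugihara_nest 1 M)"
      using assms h by (intro represented_on_cap) (simp_all add: represented_on_iff)
  qed (rule finite_cap_X)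
qed

text \<open>The points of the capped frame are coded by an old point and one of finitely many tags, and
  \<open>'x \<times> nat\<close> has the cardinality of the infinite type \<open>'x\<close>. This brings the representation back to
  the type it started from, so that the capping can be iterated.\<close>

lemma ex_inj_cap: "\<exists>f :: 'x::infinite cap \<Rightarrow> 'x. inj f"
proof -
  have "\<exists>f :: 'x \<times> nat \<Rightarrow> 'x. inj f"
    using card_of_Times_infinite[of "UNIV :: 'x set" "UNIV :: nat set"] infinite_UNIV
      infinite_iff_card_of_nat[of "UNIV :: 'x set"]
      card_of_ordLeq[of "UNIV :: ('x \<times> nat) set" "UNIV :: 'x set"]
    by (auto simp: ordIso_iff_ordLeq)
  then obtain f :: "'x \<times> nat \<Rightarrow> 'x" where f: "inj f" ..
  \<comment> \<open>Indices \<open>None\<close> and \<open>Some x\<close> are told apart by the parity of the tag.\<close>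
  define tag :: "'x option \<Rightarrow> nat \<Rightarrow> 'x \<times> nat"
    where "tag i m = (case i of None \<Rightarrow> (undefined, 2 * m + 1) | Some x \<Rightarrow> (x, 2 * m))" for i m
  define g :: "'x cap \<Rightarrow> 'x \<times> nat" where
    "g p = (case p of Core x \<Rightarrow> tag (Some x) 0 | Low i b \<Rightarrow> tag i (if b then 1 else 2)
      | High i b \<Rightarrow> tag i (if b then 3 else 4))" for p
  have tag: "tag i m = tag j n \<longleftrightarrow> i = j \<and> m = n" for i j m n
    by (cases i; cases j) (auto simp: tag_def, presburger+)
  have "inj g"
    by (rule injI) (auto simp: g_def tag split: cap.splits if_splits)
  with f show ?thesis by (blast intro: inj_compose)
qed

lemma sugihara_nest_representable_step:
  fixes M :: "'a qra"
  shows "representable TYPE('x::infinite) M \<Longrightarrow> representable TYPE('x) (sugihara_nest 1 M)"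
    and "finitely_representable TYPE('x::infinite) M \<Longrightarrow>
      finitely_representable TYPE('x) (sugihara_nest 1 M)"
proof -
  obtain f :: "'x cap \<Rightarrow> 'x" where f: "inj f" using ex_inj_cap by blast
  show "representable TYPE('x) (sugihara_nest 1 M)" if "representable TYPE('x) M"
    using that representable_mono[OF f] unfolding representable_iff
    by (metis represented_on_sugihara_nest_1)
  show "finitely_representable TYPE('x) (sugihara_nest 1 M)"
    if "finitely_representable TYPE('x) M"
    using that finitely_representable_mono[OF f] unfolding finitely_representable_iff
    by (metis represented_on_sugihara_nest_1)
qed

lemma representable_sugihara_nest:
  fixes L :: "'a qra"
  assumes "representable TYPE('x::infinite) L"
  shows "representable TYPE('x) (sugihara_nest k L)"
proof (induction k)
  case 0
  then show ?case using assms sugihara_nest_0 unfolding representable_iff by blast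
next
  case (Suc k)
  have "DqRA L" "DqRA (sugihara_nest k L)"
    using assms Suc by (simp_all add: representable_def)
  then show ?case
    using sugihara_nest_representable_step(1)[OF Suc] sugihara_nest_Suc
    unfolding representable_iff by blast
qed

lemma finitely_representable_sugihara_nest:
  fixes L :: "'a qra"
  assumes "finitely_representable TYPE('x::infinite) L"
  shows "finitely_representable TYPE('x) (sugihara_nest k L)"
proof (induction k)
  case 0
  then show ?case using assms sugihara_nest_0 unfolding finitely_representable_iff by blast
next
  case (Suc k)
  have "DqRA L" "DqRA (sugihara_nest k L)"
    using assms Suc by (simp_all add: finitely_representable_def)
  then show ?case
    using sugihara_nest_representable_step(2)[OF Suc] sugihara_nest_Suc
    unfolding finitely_representable_iff by blast
qed

theorem corollary5p4:
  fixes n :: nat and L :: "'a qra"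
  assumes "n \<ge> 3" and "odd n"
    and "DqRA L" and "representable TYPE('x::infinite) L"
  shows "representable TYPE('x) (nested_sum (sugihara n) L) \<and>
    (finitely_representable TYPE('x) L \<longrightarrow>
      finitely_representable TYPE('x) (nested_sum (sugihara n) L))"
proof -
  obtain k where "n = 2 * k + 1" using \<open>odd n\<close> by (rule oddE)
  then have "nested_sum (sugihara n) L = sugihara_nest k L"
    by (simp add: sugihara_nest_def)
  then show ?thesis
    using representable_sugihara_nest[OF assms(4)] finitely_representable_sugihara_nest by auto
qed

end
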